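(* Let $\Gamma$ be the trickle graph with vertex set $V=\mathbb Z[\frac12]\sqcup\{\infty\}$ defined in the context, whose trickle group is isomorphic to Thompson group $F$. Let $x \in \mathbb Z [\frac{1}{2}]$, let $V_x=\{y\in V\mid y\le x\}$, and let $\Gamma_x$ be the full subgraph of $\Gamma$ spanned by $V_x$, which is a parabolic subgraph of $\Gamma$. There exists a bijection $\beta: V_x \to V$ which induces an isomorphism $\beta: \mathrm{Tr}(\Gamma_x) \to \mathrm{Tr} (\Gamma)$. In particular, $\mathrm{Tr} (\Gamma_x)$ is isomorphic to $F$.
   Context: **Trickle graphs.** For a simplicial graph $\Gamma$ with vertex set $V(\Gamma)$ and edge set $E(\Gamma)$, $\mathrm{star}_x(\Gamma)$ is the full subgraph spanned by $x$ and all vertices adjacent to $x$. A trickle graph is a quadruple $(\Gamma,\le,\mu,(\varphi_x)_{x\in V(\Gamma)})$ where $\Gamma$ is a simplicial graph, $\le$ is a partial order on $V(\Gamma)$, $\mu:V(\Gamma)\to\mathbb N_{\ge 2}\cup\{\infty\}$ is a labeling, and each $\varphi_x$ is a graph automorphism of $\mathrm{star}_x(\Gamma)$, such that, writing $x||y$ if $x\not\le y$ and $y\not\le x$, and $E_{||}(\Gamma)=\{\{x,y\}\in E(\Gamma)\mid x||y\}$: (a) if $x<y$ then $\{x,y\}\in E(\Gamma)$; (b) if $\{x,y\}\in E_{||}(\Gamma)$ and $z\le y$, then $\{x,z\}\in E_{||}(\Gamma)$; (c) for $y,z\in \mathrm{star}_x(\Gamma)$: $z\le y$ iff $\varphi_x(z)\le\varphi_x(y)$;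 (d) for $y\in\mathrm{star}_x(\Gamma)$: if $\varphi_x(y)\ne y$ then $y<x$; (e) if $\mu(x)$ is finite, then $\varphi_x$ has finite order dividing $\mu(x)$; (f) $\mu(\varphi_x(y))=\mu(y)$ for $y\in \mathrm{star}_x(\Gamma)$; (g) if $z<y<x$ then $(\varphi_x\circ\varphi_y)(z)=(\varphi_{y'}\circ\varphi_x)(z)$ where $y'=\varphi_x(y)$. The trickle group is $\mathrm{Tr}(\Gamma)=\langle V(\Gamma)\mid x^{\mu(x)}=1 \text{ if }\mu(x)\ne\infty,\ \varphi_x(y)\,x=\varphi_y(x)\,y\text{ for }\{x,y\}\in E(\Gamma)\rangle$. A full subgraph $\Gamma_1$ of $\Gamma$ is parabolic if for every $x\in V(\Gamma_1)$ the map $\varphi_x$ stabilizes $\mathrm{star}_x(\Gamma_1)$ (maps it onto itself); then $\Gamma_1$ with the restricted order, labeling and automorphisms is a trickle graph, and $\mathrm{Tr}(\Gamma_1)$ denotes its trickle group. **Thompson group $F$.** $F$ is the group (under composition) of orientation preserving piecewise linear homeomorphisms $f:\mathbb R\to\mathbb R$ for which there exist $u_0<\dots<u_n$ and $v_0<\dots<v_n$ in $\mathbb Z[\frac12]$ such that $f$ maps $[u_{i-1},u_i]$ linearly onto $[v_{i-1},v_i]$ for $1\le i\le n$, is the translation $t\mapsto t+v_0-u_0$ on $(-\infty,u_0]$, and is the translation $t\mapsto t+v_n-u_n$ on $[u_n,+\infty)$. **The trickle graph.** Define $V_p\subseteq\mathbb Z[\frac12]$ and $s_p,t_p:V_p\to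 V_p$ for $p\in\mathbb N$ by induction (these $V_p$ are indexed by natural numbers and are not the sets $V_x$ of the claim). $V_0=\mathbb Z$, $s_0(x)=x+1$, $t_0(x)=x-1$. Given $V_p,s_p$: for $x\in V_p$, with $x'=s_p(x)$, and $k\in\mathbb N$ (including $0$), let $u_{p+1,k}(x)=x'-\frac{x'-x}{2^k}$; set $V_{p+1}=\bigsqcup_{x\in V_p}\{u_{p+1,k}(x)\mid k\in\mathbb N\}$ and $s_{p+1}(u_{p+1,k}(x))=u_{p+1,k+1}(x)$. Then $V_p\subset V_{p+1}$ and $\bigcup_pV_p=\mathbb Z[\frac12]$. For $p\ge1$ and $x\in V_p$: if $x\in V_{p-1}$ set $t_p(x)=t_{p-1}(x)$; otherwise $x=u_{p,k}(y)$ with $y\in V_{p-1}$, $k\ge1$, and $t_p(x)=u_{p,k-1}(y)$. Let $h_\infty(t)=t-1$. For $x\in\mathbb Z[\frac12]$, let $p\ge0$ be least with $x\in V_p$, let $x'=t_p(x)$, and for $k\ge0$ let $v_k=s_{p+1}^k(x')$ and $v_{-k}=t_p^k(x')$; then $(v_k)_{k\in\mathbb Z}$ is increasing with limits $-\infty$ and $x$ as $k\to-\infty$ and $k\to+\infty$. Let $h_x:\mathbb R\to\mathbb R$ be the homeomorphism mapping $[v_k,v_{k+1}]$ linearly (orientation preserving) onto $[v_{k-1},v_k]$ for all $k\in\mathbb Z$ and equal to the identity on $[x,+\infty)$. Each $h_x$ ($x\in V$) maps $\mathbb Z[\frac12]$ onto itself. $\Gamma$ is the complete graph on $V=\mathbb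 Z[\frac12]\sqcup\{\infty\}$; $\le$ is the total order induced from $\mathbb R$ on $\mathbb Z[\frac12]$ with $x<\infty$ for all $x\in\mathbb Z[\frac12]$; $\mu(x)=\infty$ for all $x$; $\varphi_x(\infty)=\infty$ and $\varphi_x(y)=h_x(y)$ for $y\in\mathbb Z[\frac12]$. This quadruple is a trickle graph.
   Formalization: Thompson's group F is taken with its standard definition, requiring also that all slopes be powers of 2 and that the translations near both ends be by integers; without these clauses the maps described do not form a group isomorphic to Tr(Γ). *)

theory Defs
  imports "HOL-Analysis.Analysis" "HOL-Algebra.Group" "HOL-Library.Extended_Nat"
begin

section \<open>Group presentations\<close>

text \<open>A letter \<open>(x, True)\<close> stands for the generator \<open>x\<close> and \<open>(x, False)\<close> for its inverse.\<close>

type_synonym 'a word = "('a \<times> bool) list"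

definition words :: "'a set \<Rightarrow> 'a word set" where
  "words X = lists (X \<times> UNIV)"

text \<open>A pair \<open>(u, v) \<in> R\<close> encodes the defining relation \<open>u = v\<close>.\<close>

inductive pres_eq :: "'a set \<Rightarrow> ('a word \<times> 'a word) set \<Rightarrow> 'a word \<Rightarrow> 'a word \<Rightarrow> bool"
  for X :: "'a set" and R :: "('a word \<times> 'a word) set" where
  refl: "w \<in> words X \<Longrightarrow> pres_eq X R w w"
| sym: "pres_eq X R u v \<Longrightarrow> pres_eq X R v u"
| trans: "pres_eq X R u v \<Longrightarrow> pres_eq X R v w \<Longrightarrow> pres_eq X R u w"
| append: "pres_eq X R u u' \<Longrightarrow> pres_eq X R v v' \<Longrightarrow> pres_eq X R (u @ v) (u' @ v')"
| cancel: "x \<in> X \<Longrightarrow> pres_eq X R [(x, b), (x, \<not> b)] []"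
| relation: "(u, v) \<in> R \<Longrightarrow> u \<in> words X \<Longrightarrow> v \<in> words X \<Longrightarrow> pres_eq X R u v"

definition pres_class :: "'a set \<Rightarrow> ('a word \<times> 'a word) set \<Rightarrow> 'a word \<Rightarrow> 'a word set" where
  "pres_class X R w = {w'. pres_eq X R w w'}"

definition presented_group :: "'a set \<Rightarrow> ('a word \<times> 'a word) set \<Rightarrow> 'a word set monoid" where
  "presented_group X R =
    \<lparr> carrier = pres_class X R ` words X,
      mult = (\<lambda>A B. \<Union>a\<in>A. \<Union>b\<in>B. pres_class X R (a @ b)),
      one = pres_class X R [] \<rparr>"

lemma pres_eq_words: "pres_eq X R u v \<Longrightarrow> u \<in> words X \<and> v \<in> words X"
  by (induction rule: pres_eq.induct) (auto simp: words_def)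

lemma pres_class_eq_iff:
  assumes "u \<in> words X"
  shows "pres_class X R u = pres_class X R v \<longleftrightarrow> pres_eq X R u v"
proof
  assume "pres_class X R u = pres_class X R v"
  moreover have "u \<in> pres_class X R u"
    using pres_eq.refl[OF assms] by (simp add: pres_class_def)
  ultimately show "pres_eq X R u v"
    by (simp add: pres_class_def pres_eq.sym)
next
  assume uv: "pres_eq X R u v"
  have "pres_eq X R u w \<longleftrightarrow> pres_eq X R v w" for w
    using pres_eq.trans[OF uv] pres_eq.trans[OF pres_eq.sym[OF uv]] by metis
  then show "pres_class X R u = pres_class X R v"
    by (simp add: pres_class_def)
qed

lemma presented_group_mult:
  assumes "u \<in> words X" "v \<in> words X"
  shows "pres_class X R u \<otimes>\<^bsub>presented_group X R\<^esub> pres_class X R v = pres_class X R (u @ v)"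
proof -
  have *: "pres_class X R (a @ b) = pres_class X R (u @ v)"
    if "a \<in> pres_class X R u" "b \<in> pres_class X R v" for a b
  proof -
    have "pres_eq X R (u @ v) (a @ b)"
      by (rule pres_eq.append) (use that in \<open>simp_all add: pres_class_def\<close>)
    then show ?thesis
      using pres_class_eq_iff[of "u @ v" X R "a @ b"] pres_eq_words[of X R "u @ v"] by simp
  qed
  have uv: "u \<in> pres_class X R u" "v \<in> pres_class X R v"
    using assms by (simp_all add: pres_class_def pres_eq.refl)
  have "(\<Union>a\<in>pres_class X R u. \<Union>b\<in>pres_class X R v. pres_class X R (a @ b))
      = (\<Union>a\<in>pres_class X R u. \<Union>b\<in>pres_class X R v. pres_class X R (u @ v))"
    by (intro SUP_cong HOL.refl *)
  also have "\<dots> = pres_class X R (u @ v)"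
    using uv by blast
  finally show ?thesis
    by (simp add: presented_group_def)
qed

lemma group_presented_group: "group (presented_group X R)"
proof (rule groupI)
  have app: "u @ v \<in> words X" if "u \<in> words X" "v \<in> words X" for u v :: "'a word"
    using that by (auto simp: words_def)
  have nil: "[] \<in> words X" by (simp add: words_def)
  have c: "carrier (presented_group X R) = pres_class X R ` words X"
    and o: "\<one>\<^bsub>presented_group X R\<^esub> = pres_class X R []"
    by (simp_all add: presented_group_def)
  show "\<one>\<^bsub>presented_group X R\<^esub> \<in> carrier (presented_group X R)"
    using nil by (auto simp: c o)
  fix A assume "A \<in> carrier (presented_group X R)"
  then obtain u where u: "u \<in> words X" "A = pres_class X R u" by (auto simp: c)
  show "\<one>\<^bsub>presented_group X R\<^esub> \<otimes>\<^bsub>presented_group X R\<^esub> A = A"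
    using u nil by (simp add: o presented_group_mult)
  have "\<exists>v\<in>words X. pres_eq X R (v @ u) []" using u(1)
  proof (induction u)
    case Nil
    then show ?case using pres_eq.refl[OF nil] nil by force
  next
    case (Cons p u)
    obtain x b where p: "p = (x, b)" by (cases p)
    have x: "x \<in> X" "u \<in> words X" using Cons.prems p by (auto simp: words_def)
    obtain v where v: "v \<in> words X" "pres_eq X R (v @ u) []" using Cons.IH x by blast
    have w: "v @ [(x, \<not> b)] \<in> words X" using v x by (auto simp: words_def)
    have "pres_eq X R [(x, \<not> b), (x, b)] []" using pres_eq.cancel[OF x(1), of R "\<not> b"] by simp
    then have "pres_eq X R ([(x, \<not> b), (x, b)] @ u) ([] @ u)"
      by (rule pres_eq.append) (rule pres_eq.refl[OF x(2)])
    then have "pres_eq X R (v @ [(x, \<not> b), (x, b)] @ u) (v @ [] @ u)"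
      by (rule pres_eq.append[OF pres_eq.refl[OF v(1)]])
    then have "pres_eq X R ((v @ [(x, \<not> b)]) @ p # u) []"
      using pres_eq.trans[OF _ v(2)] p by simp
    then show ?case using w by blast
  qed
  then obtain v where "v \<in> words X" "pres_eq X R (v @ u) []" by blast
  then show "\<exists>B\<in>carrier (presented_group X R). B \<otimes>\<^bsub>presented_group X R\<^esub> A = \<one>\<^bsub>presented_group X R\<^esub>"
    using u app pres_class_eq_iff[of "v @ u" X R "[]"] by (auto simp: c o presented_group_mult)
  fix B assume "B \<in> carrier (presented_group X R)"
  then obtain w where w: "w \<in> words X" "B = pres_class X R w" by (auto simp: c)
  show "A \<otimes>\<^bsub>presented_group X R\<^esub> B \<in> carrier (presented_group X R)"
    using u w app by (auto simp: c presented_group_mult)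
  fix C assume "C \<in> carrier (presented_group X R)"
  then obtain z where z: "z \<in> words X" "C = pres_class X R z" by (auto simp: c)
  show "A \<otimes>\<^bsub>presented_group X R\<^esub> B \<otimes>\<^bsub>presented_group X R\<^esub> C
      = A \<otimes>\<^bsub>presented_group X R\<^esub> (B \<otimes>\<^bsub>presented_group X R\<^esub> C)"
    using u w z app by (simp add: presented_group_mult)
qed


section \<open>Trickle graphs and trickle groups\<close>

text \<open>Only the values of \<open>po\<close>, \<open>label\<close> on vertices, and of \<open>aut x\<close> on \<open>star x\<close> for a vertex \<open>x\<close>,
  are meaningful.\<close>

record 'a trickle =
  verts :: "'a set"
  edges :: "'a set set"
  po :: "'a \<Rightarrow> 'a \<Rightarrow> bool"
  label :: "'a \<Rightarrow> enat"
  aut :: "'a \<Rightarrow> 'a \<Rightarrow> 'a"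

definition star :: "'a trickle \<Rightarrow> 'a \<Rightarrow> 'a set" where
  "star T x = {y \<in> verts T. y = x \<or> {x, y} \<in> edges T}"

definition po_strict :: "'a trickle \<Rightarrow> 'a \<Rightarrow> 'a \<Rightarrow> bool" where
  "po_strict T x y \<longleftrightarrow> po T x y \<and> x \<noteq> y"

definition par_edges :: "'a trickle \<Rightarrow> 'a set set" where
  "par_edges T = {{x, y} | x y. {x, y} \<in> edges T \<and> \<not> po T x y \<and> \<not> po T y x}"

definition trickle_graph :: "'a trickle \<Rightarrow> bool" where
  "trickle_graph T \<longleftrightarrow>
     edges T \<subseteq> {{x, y} | x y. x \<in> verts T \<and> y \<in> verts T \<and> x \<noteq> y} \<and>
     partial_order_on (verts T) {(x, y). x \<in> verts T \<and> y \<in> verts T \<and> po T x y} \<and>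
     (\<forall>x\<in>verts T. label T x \<ge> 2) \<and>
     (\<forall>x\<in>verts T. bij_betw (aut T x) (star T x) (star T x) \<and>
        (\<forall>y\<in>star T x. \<forall>z\<in>star T x. {aut T x y, aut T x z} \<in> edges T \<longleftrightarrow> {y, z} \<in> edges T)) \<and>
     (\<forall>x\<in>verts T. \<forall>y\<in>verts T. po_strict T x y \<longrightarrow> {x, y} \<in> edges T) \<and>
     (\<forall>x\<in>verts T. \<forall>y\<in>verts T. \<forall>z\<in>verts T.
        {x, y} \<in> par_edges T \<and> po T z y \<longrightarrow> {x, z} \<in> par_edges T) \<and>
     (\<forall>x\<in>verts T. \<forall>y\<in>star T x. \<forall>z\<in>star T x. po T z y \<longleftrightarrow> po T (aut T x z) (aut T x y)) \<and>
     (\<forall>x\<in>verts T. \<forall>y\<in>star T x. aut T x y \<noteq> y \<longrightarrow> po_strict T y x) \<and>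
     (\<forall>x\<in>verts T. \<forall>m. label T x = enat m \<longrightarrow>
        (\<exists>d>0. d dvd m \<and> (\<forall>y\<in>star T x. (aut T x ^^ d) y = y) \<and>
           (\<forall>e. 0 < e \<and> e < d \<longrightarrow> (\<exists>y\<in>star T x. (aut T x ^^ e) y \<noteq> y)))) \<and>
     (\<forall>x\<in>verts T. \<forall>y\<in>star T x. label T (aut T x y) = label T y) \<and>
     (\<forall>x\<in>verts T. \<forall>y\<in>verts T. \<forall>z\<in>verts T. po_strict T z y \<and> po_strict T y x \<longrightarrow>
        aut T x (aut T y z) = aut T (aut T x y) (aut T x z))"

definition full_subgraph :: "'a trickle \<Rightarrow> 'a set \<Rightarrow> 'a trickle" where
  "full_subgraph T W = T\<lparr>verts := W, edges := {e \<in> edges T. e \<subseteq> W}\<rparr>"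

definition parabolic :: "'a trickle \<Rightarrow> 'a set \<Rightarrow> bool" where
  "parabolic T W \<longleftrightarrow> W \<subseteq> verts T \<and>
     (\<forall>x\<in>W. aut T x ` star (full_subgraph T W) x = star (full_subgraph T W) x)"

definition trickle_rels :: "'a trickle \<Rightarrow> ('a word \<times> 'a word) set" where
  "trickle_rels T =
     {(replicate m (x, True), []) | x m. x \<in> verts T \<and> label T x = enat m} \<union>
     {([(aut T x y, True), (x, True)], [(aut T y x, True), (y, True)]) | x y. {x, y} \<in> edges T}"

definition Tr :: "'a trickle \<Rightarrow> 'a word set monoid" where
  "Tr T = presented_group (verts T) (trickle_rels T)"

definition Tr_gen :: "'a trickle \<Rightarrow> 'a \<Rightarrow> 'a word set" where
  "Tr_gen T x = pres_class (verts T) (trickle_rels T) [(x, True)]"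

definition induces_iso :: "'a trickle \<Rightarrow> 'b trickle \<Rightarrow> ('a \<Rightarrow> 'b) \<Rightarrow> bool" where
  "induces_iso S T \<beta> \<longleftrightarrow>
     (\<exists>\<Phi>\<in>iso (Tr S) (Tr T). \<forall>x\<in>verts S. \<Phi> (Tr_gen S x) = Tr_gen T (\<beta> x))"


section \<open>Thompson's group F\<close>

definition dyadic_rats :: "real set" where
  "dyadic_rats = {of_int a / 2 ^ n | (a :: int) (n :: nat). True}"

text \<open>
  Besides dyadic breakpoints with dyadic images, the standard definition of \<open>F\<close> as a group of
  homeomorphisms of the line requires all slopes to be powers of 2 and the translations near
  the two ends to be by integers. Without the slope condition the set is not closed
  under composition, and without the integrality condition its abelianization is not
  finitely generated; both conditions are therefore stated explicitly.
\<close>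

definition thompson_maps :: "(real \<Rightarrow> real) set" where
  "thompson_maps = {f. (\<exists>g. homeomorphism UNIV UNIV f g) \<and> strict_mono f \<and>
     (\<exists>(n :: nat) (u :: nat \<Rightarrow> real) (v :: nat \<Rightarrow> real).
        (\<forall>i\<le>n. u i \<in> dyadic_rats \<and> v i \<in> dyadic_rats) \<and>
        (\<forall>i<n. u i < u (Suc i) \<and> v i < v (Suc i)) \<and>
        (\<forall>i<n. \<forall>t\<in>{u i..u (Suc i)}.
           f t = v i + (v (Suc i) - v i) / (u (Suc i) - u i) * (t - u i)) \<and>
        (\<forall>i<n. \<exists>k :: int. (v (Suc i) - v i) / (u (Suc i) - u i) = 2 powi k) \<and>
        (\<forall>t\<le>u 0. f t = t + v 0 - u 0) \<and> v 0 - u 0 \<in> \<int> \<and>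
        (\<forall>t\<ge>u n. f t = t + v n - u n) \<and> v n - u n \<in> \<int>)}"

definition thompson_F :: "(real \<Rightarrow> real) monoid" where
  "thompson_F = \<lparr> carrier = thompson_maps, mult = (\<lambda>f g. f \<circ> g), one = id \<rparr>"


section \<open>The trickle graph on the dyadic rationals and infinity\<close>

text \<open>\<open>subdiv a b k\<close> is the point \<open>u\<^sub>k\<close> of the subdivision of \<open>[a, b)\<close>.\<close>

definition subdiv :: "real \<Rightarrow> real \<Rightarrow> nat \<Rightarrow> real" where
  "subdiv a b k = b - (b - a) / 2 ^ k"

text \<open>
  \<open>lev p\<close> is \<open>V\<^sub>p\<close>, with \<open>lev_succ p\<close> and \<open>lev_pred p\<close> for \<open>s\<^sub>p\<close> and \<open>t\<^sub>p\<close>. Each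
  \<open>y \<in> lev (Suc p)\<close> is \<open>subdiv x (lev_succ p x) k\<close> for a unique \<open>x \<in> lev p\<close> and \<open>k\<close>, so the
  definite descriptions are well defined; the values outside \<open>lev p\<close> are irrelevant.
\<close>

fun lev :: "nat \<Rightarrow> real set" and lev_succ :: "nat \<Rightarrow> real \<Rightarrow> real" where
  "lev 0 = \<int>"
| "lev (Suc p) = {subdiv x (lev_succ p x) k | x k. x \<in> lev p}"
| "lev_succ 0 y = y + 1"
| "lev_succ (Suc p) y = (THE z. \<exists>x\<in>lev p. \<exists>k.
     y = subdiv x (lev_succ p x) k \<and> z = subdiv x (lev_succ p x) (Suc k))"

fun lev_pred :: "nat \<Rightarrow> real \<Rightarrow> real" where
  "lev_pred 0 y = y - 1"
| "lev_pred (Suc p) y =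
     (if y \<in> lev p then lev_pred p y
      else (THE z. \<exists>x\<in>lev p. \<exists>k.
        y = subdiv x (lev_succ p x) (Suc k) \<and> z = subdiv x (lev_succ p x) k))"

definition depth :: "real \<Rightarrow> nat" where
  "depth x = (LEAST p. x \<in> lev p)"

text \<open>\<open>approach x k\<close> is \<open>v\<^sub>k\<close>: it tends to \<open>x\<close> as \<open>k \<rightarrow> \<infinity>\<close> and to \<open>-\<infinity>\<close> as \<open>k \<rightarrow> -\<infinity>\<close>.\<close>

definition approach :: "real \<Rightarrow> int \<Rightarrow> real" where
  "approach x k =
     (let p = depth x; x' = lev_pred p x
      in if k \<ge> 0 then (lev_succ (Suc p) ^^ nat k) x' else (lev_pred p ^^ nat (- k)) x')"

definition hmap :: "real \<Rightarrow> real \<Rightarrow> real" where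
  "hmap x t =
     (if x \<le> t then t
      else let k = (THE k. approach x k \<le> t \<and> t < approach x (k + 1))
           in approach x (k - 1) +
              (approach x k - approach x (k - 1)) / (approach x (k + 1) - approach x k) *
              (t - approach x k))"

definition hmap_ext :: "ereal \<Rightarrow> real \<Rightarrow> real" where
  "hmap_ext a t = (if a = \<infinity> then t - 1 else hmap (real_of_ereal a) t)"

definition dyadic_verts :: "ereal set" where
  "dyadic_verts = ereal ` dyadic_rats \<union> {\<infinity>}"

definition dyadic_trickle :: "ereal trickle" where
  "dyadic_trickle =
     \<lparr> verts = dyadic_verts,
       edges = {{a, b} | a b. a \<in> dyadic_verts \<and> b \<in> dyadic_verts \<and> a \<noteq> b},
       po = (\<le>),
       label = (\<lambda>_. \<infinity>),
       aut = (\<lambda>a b. if b = \<infinity> then \<infinity> else ereal (hmap_ext a (real_of_ereal b))) \<rparr>"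

definition below :: "real \<Rightarrow> ereal set" where
  "below x = {y \<in> verts dyadic_trickle. po dyadic_trickle y (ereal x)}"

end

theory Submission
  imports Defs
begin

text \<open>Write \<open>h\<^sub>a\<close> for the homeomorphism of the line attached to a vertex \<open>a\<close>, so that \<open>h\<^sub>\<infinity>\<close> is
the translation by \<open>-1\<close>. Everything rests on one rule (\<open>hmap_conj\<close>): for \<open>b < a\<close>, conjugation by
\<open>h\<^sub>a\<close> turns \<open>h\<^sub>b\<close> into the homeomorphism attached to \<open>h\<^sub>a b\<close>. Evaluated at vertices it is the axiom
on nested automorphisms of a trickle graph; as an identity of maps it says that \<open>a \<mapsto> h\<^sub>a\<close> respects
the defining relations of the trickle group.

The rule holds because the sequence approaching \<open>x\<close> is governed by a local quantity. Let \<open>ulp y\<close> be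
the largest \<open>2\<^sup>-\<^sup>m \<le> 1\<close> of which the dyadic number \<open>y\<close> is a multiple. The sequence consists of the points
\<open>x - ulp x / 2\<^sup>k\<close>, continued to the left by the step \<open>y \<mapsto> y - ulp y\<close>. A monotone map \<open>g\<close> that carries
the ulp interval \<open>[y - ulp y, y]\<close> affinely onto the one of \<open>g y\<close>, for all dyadic \<open>y \<le> x\<close>,
therefore conjugates \<open>h\<^sub>x\<close> to the homeomorphism attached to \<open>g x\<close> (\<open>hmap_semiconj\<close>). For an
integer \<open>n\<close> the map \<open>h\<^sub>n\<close> is the translation by \<open>-1\<close> up to \<open>n - 1\<close> and doubles the distance to \<open>n\<close> on
\<open>[n - 1, n]\<close>; it has this property below \<open>n\<close>. Every dyadic \<open>x\<close> that is not an integer is moved by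
the map of the next integer to a dyadic number with a smaller denominator. Statements about all \<open>h\<^sub>x\<close>
thus reduce to integers (\<open>dyadic_hmap_induct\<close>).

The trickle group is Thompson's group. For injectivity take a word acting as the identity. The
conjugation rule moves all occurrences of its largest letter \<open>a\<close> to the right, which leaves a shorter
word in letters below \<open>a\<close>, followed by a power of \<open>a\<close>. Just below \<open>a\<close> the shorter word acts
trivially, whereas a nonzero power of \<open>h\<^sub>a\<close> moves every point below \<open>a\<close>; so the power is trivial and
induction on the length applies (\<open>word_map_kernel\<close>). For surjectivity, precompose an element of \<open>F\<close>
with a word map so that all unit intervals are sent affinely onto standard dyadic intervals
(\<open>dyadic_pl_standard\<close>). A smallest image interval is a half of a larger standard interval whose other
half is also an image, and one map \<open>h\<^sub>n\<close> merges the two; after finitely many merges an integral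
translation is left (\<open>standard_on_units_word_map\<close>).

For the bijection, note that \<open>h\<^sub>x\<close> is the translation by \<open>-1\<close> far to the left and pushes every
point below \<open>x\<close> there. Hence \<open>h\<^sub>x\<^sup>k t + k\<close> is eventually constant in \<open>k\<close>; its limit \<open>\<beta> t\<close>, together with
\<open>\<beta> x = \<infinity>\<close>, identifies the vertices up to \<open>x\<close> with all vertices. The maps \<open>h\<^sub>x\<^sup>k + k\<close> conjugate each
\<open>h\<^sub>a\<close> with \<open>a < x\<close> to the homeomorphism attached to the image of \<open>a\<close>, and so does their limit. So
\<open>\<beta>\<close> carries the defining relations of one trickle group onto those of the other.\<close>

section \<open>The unit of a dyadic rational and the approaching sequence\<close>

lemma dyadic_iff: "y \<in> dyadic_rats \<longleftrightarrow> (\<exists>m. 2 ^ m * y \<in> \<int>)"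
proof
  assume "y \<in> dyadic_rats"
  then obtain a :: int and n :: nat where "y = of_int a / 2 ^ n"
    by (auto simp: dyadic_rats_def)
  then have "2 ^ n * y = of_int a" by simp
  then show "\<exists>m. 2 ^ m * y \<in> \<int>" by (metis Ints_of_int)
next
  assume "\<exists>m. 2 ^ m * y \<in> \<int>"
  then obtain m a where "2 ^ m * y = of_int a" by (auto elim: Ints_cases)
  then have "y = of_int a / 2 ^ m" by (simp add: field_simps)
  then show "y \<in> dyadic_rats" by (auto simp: dyadic_rats_def)
qed

lemma dyadic_add:
  assumes "x \<in> dyadic_rats" "y \<in> dyadic_rats" shows "x + y \<in> dyadic_rats"
proof -
  obtain m n where *: "2 ^ m * x \<in> \<int>" "2 ^ n * y \<in> \<int>" using assms by (auto simp: dyadic_iff)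
  have "2 ^ (m + n) * (x + y) = 2 ^ n * (2 ^ m * x) + 2 ^ m * (2 ^ n * y)"
    by (simp add: algebra_simps power_add)
  also have "\<dots> \<in> \<int>" by (intro Ints_add Ints_mult[OF _ *(1)] Ints_mult[OF _ *(2)]) auto
  finally show ?thesis unfolding dyadic_iff by blast
qed

lemma dyadic_mult:
  assumes "x \<in> dyadic_rats" "y \<in> dyadic_rats" shows "x * y \<in> dyadic_rats"
proof -
  obtain m n where *: "2 ^ m * x \<in> \<int>" "2 ^ n * y \<in> \<int>" using assms by (auto simp: dyadic_iff)
  have "2 ^ (m + n) * (x * y) = (2 ^ m * x) * (2 ^ n * y)"
    by (simp add: algebra_simps power_add)
  also have "\<dots> \<in> \<int>" by (rule Ints_mult[OF *])
  finally show ?thesis unfolding dyadic_iff by blast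
qed

lemma Ints_dyadic: "x \<in> \<int> \<Longrightarrow> x \<in> dyadic_rats"
  by (auto simp: dyadic_iff intro: exI[of _ 0])

lemma dyadic_minus: "x \<in> dyadic_rats \<Longrightarrow> - x \<in> dyadic_rats"
  using dyadic_mult[of "-1" x] by (simp add: Ints_dyadic)

lemma dyadic_diff: "x \<in> dyadic_rats \<Longrightarrow> y \<in> dyadic_rats \<Longrightarrow> x - y \<in> dyadic_rats"
  using dyadic_add[of x "- y"] dyadic_minus by simp

lemma dyadic_inverse_power: "1 / 2 ^ m \<in> dyadic_rats"
  by (auto simp: dyadic_iff intro!: exI[of _ m])

lemma dyadic_powi: "2 powi k \<in> dyadic_rats"
  using dyadic_inverse_power[of "nat (- k)"]
  by (cases "k \<ge> 0") (auto simp: power_int_def inverse_eq_divide power_one_over Ints_dyadic)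

text \<open>The largest power \<open>2\<^sup>-\<^sup>m \<le> 1\<close> of which the dyadic number \<open>y\<close> is an integral multiple: the unit in
  the last place of its binary expansion, with value 1 at the integers.\<close>

definition ulp :: "real \<Rightarrow> real" where
  "ulp y = 1 / 2 ^ (LEAST m. 2 ^ m * y \<in> \<int>)"

lemma ulp_pos: "0 < ulp y" by (simp add: ulp_def)

lemma ulp_le_1: "ulp y \<le> 1" by (simp add: ulp_def)

lemma ulp_dyadic: "ulp y \<in> dyadic_rats"
  unfolding ulp_def by (rule dyadic_inverse_power)

lemma ulp_ge: "2 ^ m * y \<in> \<int> \<Longrightarrow> 1 / 2 ^ m \<le> ulp y"
  by (auto simp: ulp_def field_simps intro!: power_increasing Least_le)

lemma ulp_Ints: "y \<in> \<int> \<Longrightarrow> ulp y = 1"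
  using ulp_ge[of 0 y] ulp_le_1[of y] by simp

lemma ulp_odd:
  assumes "odd a"
  shows "ulp (of_int a / 2 ^ m) = 1 / 2 ^ m"
proof -
  have "m \<le> j" if "2 ^ j * (of_int a / 2 ^ m :: real) \<in> \<int>" for j
  proof (rule ccontr)
    assume "\<not> m \<le> j"
    then obtain i where m: "m = j + Suc i" by (metis less_imp_Suc_add not_le add_Suc_right)
    obtain b where "2 ^ j * (of_int a / 2 ^ m :: real) = of_int b" using \<open>_ \<in> \<int>\<close> by (rule Ints_cases)
    then have "real_of_int a = of_int (b * 2 ^ Suc i)" by (simp add: m power_add field_simps)
    then have "a = b * 2 ^ Suc i" by (simp only: of_int_eq_iff)
    with assms show False by simp
  qed
  then have "(LEAST j. 2 ^ j * (of_int a / 2 ^ m :: real) \<in> \<int>) = m"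
    by (intro Least_equality) auto
  then show ?thesis by (simp add: ulp_def)
qed

lemma dyadic_cases:
  assumes "y \<in> dyadic_rats"
  obtains (int) "y \<in> \<int>" "ulp y = 1"
  | (frac) a m where "odd a" "y = of_int a / 2 ^ Suc m" "ulp y = 1 / 2 ^ Suc m" "y \<notin> \<int>"
proof (cases "y \<in> \<int>")
  case True
  then show thesis using int ulp_Ints by blast
next
  case False
  define m where "m = (LEAST m. 2 ^ m * y \<in> \<int>)"
  have mi: "2 ^ m * y \<in> \<int>" using assms unfolding dyadic_iff m_def by (rule LeastI_ex)
  have "m \<noteq> 0" using mi False by (auto intro: ccontr)
  then obtain n where n: "m = Suc n" by (cases m) auto
  obtain a where a: "2 ^ m * y = of_int a" using mi by (rule Ints_cases)
  have "odd a"
  proof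
    assume "even a"
    then obtain b where "a = 2 * b" ..
    then have "2 ^ n * y = of_int b" using a n by simp
    then have "m \<le> n" unfolding m_def by (intro Least_le) simp
    then show False using n by simp
  qed
  moreover have "y = of_int a / 2 ^ Suc n" using a n by (simp add: field_simps)
  ultimately show thesis using frac ulp_odd False by blast
qed

lemma ulp_multiple:
  assumes "y \<in> dyadic_rats" obtains a :: int where "y = of_int a * ulp y"
  using assms
proof (cases rule: dyadic_cases)
  case int
  then show ?thesis using that by (auto elim: Ints_cases)
next
  case (frac a m)
  then show ?thesis using that[of a] by simp
qed

lemma ulp_add_Ints:
  assumes "i \<in> \<int>" shows "ulp (y + i) = ulp y"
proof -
  have "2 ^ m * (y + i) \<in> \<int> \<longleftrightarrow> 2 ^ m * y \<in> \<int>" for m :: nat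
  proof -
    have "2 ^ m * i \<in> \<int>" using assms by (intro Ints_mult) auto
    then show ?thesis
      using Ints_add[of "2 ^ m * y" "2 ^ m * i"] Ints_diff[of "2 ^ m * (y + i)" "2 ^ m * i"]
      by (auto simp: algebra_simps)
  qed
  then show ?thesis by (simp add: ulp_def)
qed

text \<open>Doubling a fraction cancels one factor from its denominator; an integer has none to
  cancel, and its unit stays 1.\<close>

lemma ulp_double:
  assumes "y \<in> dyadic_rats" "y \<notin> \<int>" shows "ulp (2 * y) = 2 * ulp y"
  using assms(1)
proof (cases rule: dyadic_cases)
  case int
  then show ?thesis using assms by simp
next
  case (frac a m)
  then have "2 * y = of_int a / 2 ^ m" by simp
  then show ?thesis using ulp_odd[OF frac(1), of m] frac(3) by simp
qed

text \<open>If \<open>y = a / 2\<^sup>m\<close> has unit \<open>2\<^sup>-\<^sup>m\<close>, the point has the odd numerator \<open>2\<^sup>k\<^sup>+\<^sup>1 a - 1\<close> over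
  \<open>2\<^sup>m\<^sup>+\<^sup>k\<^sup>+\<^sup>1\<close>. So each term of the sequence increasing to \<open>y\<close> is exactly one unit above its
  predecessor.\<close>

lemma ulp_approach:
  assumes "y \<in> dyadic_rats"
  shows "ulp (y - ulp y / 2 ^ Suc k) = ulp y / 2 ^ Suc k"
proof -
  obtain a :: int and m where y: "y = of_int a / 2 ^ m" and u: "ulp y = 1 / 2 ^ m"
    using assms
  proof (cases rule: dyadic_cases)
    case int
    then show ?thesis using that[of _ 0] by (auto elim: Ints_cases)
  next
    case (frac a m)
    then show ?thesis using that by blast
  qed
  have "y - ulp y / 2 ^ Suc k = of_int (2 ^ Suc k * a - 1) / 2 ^ (m + Suc k)"
    unfolding u unfolding y by (simp add: field_simps power_add)
  also have "ulp \<dots> = 1 / 2 ^ (m + Suc k)" by (rule ulp_odd) simp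
  finally show ?thesis by (simp add: u power_add)
qed

lemma subdiv_0: "subdiv a b 0 = a" by (simp add: subdiv_def)

lemma subdiv_less: "a < b \<Longrightarrow> subdiv a b k < b" by (simp add: subdiv_def)

lemma subdiv_ge: "a < b \<Longrightarrow> a \<le> subdiv a b k"
  using divide_left_mono[of 1 "2 ^ k" "b - a"] by (simp add: subdiv_def)

lemma subdiv_strict_mono: "a < b \<Longrightarrow> k < k' \<Longrightarrow> subdiv a b k < subdiv a b k'"
  by (simp add: subdiv_def divide_strict_left_mono)

lemma subdiv_mono: "a < b \<Longrightarrow> k \<le> k' \<Longrightarrow> subdiv a b k \<le> subdiv a b k'"
  using subdiv_strict_mono[of a b k k'] by (cases "k = k'") auto

lemma subdiv_eqD: "a < b \<Longrightarrow> subdiv a b k = subdiv a b k' \<Longrightarrow> k = k'"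
  using subdiv_strict_mono[of a b] by (metis less_irrefl nat_neq_iff)

declare lev_succ.simps(2) [simp del]

definition lev_ok :: "nat \<Rightarrow> bool" where
  "lev_ok p \<longleftrightarrow> (\<forall>a\<in>lev p.
     (\<exists>j. lev_succ p a = a + 1 / 2 ^ j \<and> 2 ^ j * a \<in> \<int>) \<and> lev_succ p a \<in> lev p \<and>
     (\<forall>a'\<in>lev p. a < a' \<longrightarrow> lev_succ p a \<le> a'))"

lemma lev_ok_less: "lev_ok p \<Longrightarrow> a \<in> lev p \<Longrightarrow> a < lev_succ p a"
  unfolding lev_ok_def by (metis less_add_same_cancel1 zero_less_divide_1_iff zero_less_numeral zero_less_power)

text \<open>The intervals from \<open>a\<close> to its successor are disjoint for distinct \<open>a\<close> of the same level, so a
  point of the next level determines both the interval that contains it and its index there. This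
  makes the definite descriptions in the definition of the levels well defined.\<close>

lemma subdiv_unique:
  assumes ok: "lev_ok p" and a: "a \<in> lev p" "a' \<in> lev p"
    and eq: "subdiv a (lev_succ p a) k = subdiv a' (lev_succ p a') k'"
  shows "a = a' \<and> k = k'"
proof -
  have *: False if "b \<in> lev p" "b' \<in> lev p" "b < b'"
    "subdiv b (lev_succ p b) i = subdiv b' (lev_succ p b') i'" for b b' i i'
  proof -
    have "lev_succ p b \<le> b'" using ok that by (auto simp: lev_ok_def)
    then show False
      using subdiv_less[OF lev_ok_less[OF ok that(1)], of i] subdiv_ge[OF lev_ok_less[OF ok that(2)], of i'] that(4)
      by simp
  qed
  have "a = a'" using *[OF a _ eq] *[OF a(2,1) _ eq[symmetric]] by (metis linorder_neqE)
  then show ?thesis using eq subdiv_eqD lev_ok_less[OF ok a(1)] by blast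
qed

lemma lev_succ_subdiv:
  assumes ok: "lev_ok p" and a: "a \<in> lev p"
  shows "lev_succ (Suc p) (subdiv a (lev_succ p a) k) = subdiv a (lev_succ p a) (Suc k)"
  unfolding lev_succ.simps(2) using a subdiv_unique[OF ok] by (intro the_equality) blast+

lemma lev_pred_subdiv:
  assumes ok: "lev_ok p" and a: "a \<in> lev p" and n: "subdiv a (lev_succ p a) (Suc k) \<notin> lev p"
  shows "lev_pred (Suc p) (subdiv a (lev_succ p a) (Suc k)) = subdiv a (lev_succ p a) k"
proof -
  have "(THE z. \<exists>x\<in>lev p. \<exists>i.
        subdiv a (lev_succ p a) (Suc k) = subdiv x (lev_succ p x) (Suc i)
        \<and> z = subdiv x (lev_succ p x) i) = subdiv a (lev_succ p a) k"
    using a subdiv_unique[OF ok a] by (intro the_equality) blast+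
  then show ?thesis using n by simp
qed

lemma subdiv_power:
  "b = a + 1 / 2 ^ j \<Longrightarrow> subdiv a b k = b - 1 / 2 ^ (j + k)"
  by (simp add: subdiv_def power_add)

lemma lev_ok: "lev_ok p"
proof (induction p)
  case 0
  have "a + 1 \<le> a'" if "a \<in> \<int>" "a' \<in> \<int>" "a < a'" for a a' :: real
    using that by (auto elim!: Ints_cases)
  then show ?case by (auto simp: lev_ok_def intro!: exI[of _ 0])
next
  case (Suc p)
  show ?case unfolding lev_ok_def
  proof (intro ballI conjI impI)
    fix y assume "y \<in> lev (Suc p)"
    then obtain a k where a: "a \<in> lev p" and y: "y = subdiv a (lev_succ p a) k" by auto
    have s: "lev_succ (Suc p) y = subdiv a (lev_succ p a) (Suc k)"
      unfolding y by (rule lev_succ_subdiv[OF Suc a])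
    show "lev_succ (Suc p) y \<in> lev (Suc p)" unfolding s using a by auto
    obtain j where j: "lev_succ p a = a + 1 / 2 ^ j" "2 ^ j * a \<in> \<int>"
      using Suc a by (auto simp: lev_ok_def)
    have sub: "subdiv a (lev_succ p a) i = a + 1 / 2 ^ j - 1 / 2 ^ (j + i)" for i
      unfolding j(1) by (rule subdiv_power) (rule HOL.refl)
    have "2 ^ (j + Suc k) * y = 2 ^ Suc k * (2 ^ j * a) + (2 ^ Suc k - 2)"
      unfolding y sub by (simp add: power_add field_simps)
    also have "\<dots> \<in> \<int>" by (intro Ints_add Ints_mult[OF _ j(2)] Ints_diff) auto
    finally have "2 ^ (j + Suc k) * y \<in> \<int>" .
    moreover have "lev_succ (Suc p) y = y + 1 / 2 ^ (j + Suc k)"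
      unfolding s unfolding y sub by (simp add: power_add)
    ultimately show "\<exists>j. lev_succ (Suc p) y = y + 1 / 2 ^ j \<and> 2 ^ j * y \<in> \<int>"
      by blast
    fix y' assume "y' \<in> lev (Suc p)" and less: "y < y'"
    then obtain a' k' where a': "a' \<in> lev p" and y': "y' = subdiv a' (lev_succ p a') k'" by auto
    have lt: "a < lev_succ p a" "a' < lev_succ p a'" using lev_ok_less[OF Suc] a a' by auto
    consider "a < a'" | "a = a'" | "a' < a" by linarith
    then show "lev_succ (Suc p) y \<le> y'"
    proof cases
      case 1
      then have "lev_succ p a \<le> a'" using Suc a a' by (auto simp: lev_ok_def)
      then show ?thesis using subdiv_less[OF lt(1), of "Suc k"] subdiv_ge[OF lt(2), of k'] s y' by simp
    next
      case 2
      have "k < k'" using less subdiv_mono[OF lt(1), of k' k] y y' 2 by (metis not_le)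
      then show ?thesis using subdiv_mono[OF lt(1), of "Suc k" k'] s y' 2 by simp
    next
      case 3
      then have "lev_succ p a' \<le> a" using Suc a a' by (auto simp: lev_ok_def)
      then show ?thesis using subdiv_less[OF lt(2), of k'] subdiv_ge[OF lt(1), of k] less y y' by simp
    qed
  qed
qed

lemma lev_mono: "lev p \<subseteq> lev (Suc p)"
proof
  fix a assume "a \<in> lev p"
  then show "a \<in> lev (Suc p)"
    unfolding lev.simps using subdiv_0[of a "lev_succ p a"] by (metis (mono_tags, lifting) mem_Collect_eq)
qed

text \<open>If the interval has length \<open>2\<^sup>-\<^sup>j\<close> and ends at \<open>b\<close>, a multiple of \<open>2\<^sup>-\<^sup>j\<close>, then the point with index
  \<open>k + 1\<close> is \<open>b - 2\<^sup>-\<^sup>j\<^sup>-\<^sup>k\<^sup>-\<^sup>1\<close>. Its numerator over \<open>2\<^sup>j\<^sup>+\<^sup>k\<^sup>+\<^sup>1\<close> is odd, and the step back to the point with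
  index \<open>k\<close> has the same length.\<close>

lemma ulp_subdiv:
  assumes "a \<in> lev p"
  shows "ulp (subdiv a (lev_succ p a) (Suc k))
    = subdiv a (lev_succ p a) (Suc k) - subdiv a (lev_succ p a) k"
proof -
  obtain j where j: "lev_succ p a = a + 1 / 2 ^ j" "2 ^ j * a \<in> \<int>"
    using lev_ok[of p] assms by (auto simp: lev_ok_def)
  obtain i where i: "2 ^ j * a = of_int i" using j(2) by (rule Ints_cases)
  have a: "a = of_int i / 2 ^ j" using i by (simp add: field_simps)
  have sub: "subdiv a (lev_succ p a) n = of_int i / 2 ^ j + 1 / 2 ^ j - 1 / 2 ^ (j + n)" for n
    unfolding j(1) unfolding a by (rule subdiv_power) (rule HOL.refl)
  have "subdiv a (lev_succ p a) (Suc k) = of_int (2 ^ Suc k * (i + 1) - 1) / 2 ^ (j + Suc k)"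
    unfolding sub by (simp add: power_add field_simps)
  also have "ulp \<dots> = 1 / 2 ^ (j + Suc k)" by (rule ulp_odd) simp
  finally show ?thesis unfolding sub by (simp add: power_add)
qed

text \<open>The predecessor of a point does not depend on the level: it is one unit to the left.\<close>

lemma lev_pred_eq:
  "y \<in> lev p \<Longrightarrow> lev_pred p y = y - ulp y \<and> lev_pred p y \<in> lev p"
proof (induction p)
  case 0
  then show ?case by (simp add: ulp_Ints)
next
  case (Suc p)
  show ?case
  proof (cases "y \<in> lev p")
    case True
    then show ?thesis using Suc.IH lev_mono[of p] by auto
  next
    case False
    obtain a k where a: "a \<in> lev p" and y: "y = subdiv a (lev_succ p a) k" using Suc.prems by auto
    have "k \<noteq> 0" using a y False by (metis subdiv_0)
    then obtain i where i: "k = Suc i" by (cases k) auto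
    have "lev_pred (Suc p) y = subdiv a (lev_succ p a) i"
      unfolding y i by (rule lev_pred_subdiv[OF lev_ok a]) (use False y i in simp)
    then show ?thesis using ulp_subdiv[OF a, of i] y i a by auto
  qed
qed

text \<open>Bisection of the part of an interval to the right of a subdivision point: the left half is
  an interval of the next level, and the right half is again such a part, with the next index. Each step
  removes one factor 2 from the denominator of the relative position of \<open>y\<close>.\<close>

lemma dyadic_in_subdiv:
  "a \<in> lev p \<Longrightarrow> subdiv a (lev_succ p a) k \<le> y \<Longrightarrow> y < lev_succ p a \<Longrightarrow>
   2 ^ m * (y - subdiv a (lev_succ p a) k) / (lev_succ p a - subdiv a (lev_succ p a) k) \<in> \<int> \<Longrightarrow>
   \<exists>q. y \<in> lev q"
proof (induction m arbitrary: p a k)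
  case 0
  define b where "b = lev_succ p a"
  define u where "u = subdiv a b k"
  have ab: "a < b" using lev_ok_less[OF lev_ok 0(1)] b_def by simp
  have ub: "u < b" unfolding u_def using ab by (rule subdiv_less)
  have r: "0 \<le> (y - u) / (b - u)" "(y - u) / (b - u) < 1" using 0 ub by (auto simp: u_def b_def)
  have "(y - u) / (b - u) \<in> \<int>" using 0(4) by (simp add: u_def b_def)
  then obtain z where "(y - u) / (b - u) = of_int z" by (rule Ints_cases)
  with r have "(y - u) / (b - u) = 0" by simp
  then have "y = u" using ub by simp
  then have "y \<in> lev (Suc p)" using 0(1) by (auto simp: u_def b_def)
  then show ?case ..
next
  case (Suc m)
  define b where "b = lev_succ p a"
  define u where "u = subdiv a b k"
  define c where "c = subdiv a b (Suc k)"
  have ab: "a < b" using lev_ok_less[OF lev_ok Suc(2)] b_def by simp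
  have ub: "u < b" unfolding u_def using ab by (rule subdiv_less)
  have c: "c = (u + b) / 2" by (simp add: c_def u_def subdiv_def field_simps)
  have y: "2 ^ Suc m * (y - u) / (b - u) \<in> \<int>" "u \<le> y" "y < b"
    using Suc.prems by (auto simp: u_def b_def)
  have u: "u \<in> lev (Suc p)" using Suc.prems(1) by (auto simp: u_def b_def)
  have su: "lev_succ (Suc p) u = c"
    unfolding u_def c_def b_def by (rule lev_succ_subdiv[OF lev_ok Suc.prems(1)])
  show ?case
  proof (cases "y < c")
    case True
    have "2 ^ m * (y - u) / (c - u) = 2 ^ Suc m * (y - u) / (b - u)"
      using ub unfolding c by (simp add: field_simps)
    then show ?thesis
      using Suc.IH[OF u, of 0] y True unfolding su subdiv_0 by (simp del: lev.simps)
  next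
    case False
    have "2 ^ m * (y - c) / (b - c) = 2 ^ Suc m * (y - u) / (b - u) - 2 ^ m"
      using ub unfolding c by (simp add: field_simps)
    also have "\<dots> \<in> \<int>" using y by (intro Ints_diff) auto
    finally show ?thesis
      using Suc.IH[of a p "Suc k"] Suc.prems(1) y False by (simp add: b_def c_def)
  qed
qed

lemma dyadic_in_lev:
  assumes "y \<in> dyadic_rats" shows "\<exists>p. y \<in> lev p"
proof -
  obtain m where "2 ^ m * y \<in> \<int>" using assms by (auto simp: dyadic_iff)
  then have "2 ^ m * y - 2 ^ m * of_int \<lfloor>y\<rfloor> \<in> \<int>" by (rule Ints_diff) auto
  moreover have "y < of_int \<lfloor>y\<rfloor> + 1" by linarith
  ultimately show ?thesis
    using dyadic_in_subdiv[of "of_int \<lfloor>y\<rfloor>" 0 0 y m]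
    by (simp add: subdiv_0 algebra_simps)
qed

text \<open>To the right of its starting point the sequence subdivides the interval of the predecessor of
  \<open>x\<close>, whose successor at the depth of \<open>x\<close> is \<open>x\<close> itself.\<close>

lemma approach_nonneg:
  assumes "x \<in> dyadic_rats"
  shows "approach x (int k) = x - ulp x / 2 ^ k"
proof -
  define p where "p = depth x"
  have x: "x \<in> lev p" using dyadic_in_lev[OF assms] unfolding p_def depth_def by (rule LeastI_ex)
  define x' where "x' = lev_pred p x"
  have x': "x' \<in> lev p" "x' = x - ulp x" using lev_pred_eq[OF x] by (auto simp: x'_def)
  have succ: "lev_succ p x' = x"
  proof (cases p)
    case 0
    then show ?thesis using x x' by (simp add: ulp_Ints)
  next
    case (Suc q)
    then obtain a i where a: "a \<in> lev q" and xa: "x = subdiv a (lev_succ q a) i" using x by auto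
    have nx: "x \<notin> lev q" using Suc not_less_Least[of q "\<lambda>p. x \<in> lev p"] by (simp add: p_def depth_def)
    then have "i \<noteq> 0" using a xa by (metis subdiv_0)
    then obtain j where j: "i = Suc j" by (cases i) auto
    have "x' = subdiv a (lev_succ q a) j"
      unfolding x'_def xa j Suc by (rule lev_pred_subdiv[OF lev_ok a]) (use nx xa j in simp)
    then show ?thesis using lev_succ_subdiv[OF lev_ok a, of j] xa j Suc by simp
  qed
  have "(lev_succ (Suc p) ^^ k) x' = subdiv x' x k"
  proof (induction k)
    case 0
    then show ?case by (simp add: subdiv_0)
  next
    case (Suc k)
    then show ?case using lev_succ_subdiv[OF lev_ok x'(1), of k] by (simp add: succ)
  qed
  then show ?thesis
    by (simp add: approach_def Let_def p_def[symmetric] x'_def[symmetric] subdiv_def x'(2))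
qed

lemma approach_neg:
  assumes "x \<in> dyadic_rats"
  shows "approach x (- int k) = ((\<lambda>y. y - ulp y) ^^ Suc k) x"
proof -
  define p where "p = depth x"
  have x: "x \<in> lev p" using dyadic_in_lev[OF assms] unfolding p_def depth_def by (rule LeastI_ex)
  have *: "(lev_pred p ^^ i) y = ((\<lambda>y. y - ulp y) ^^ i) y \<and> (lev_pred p ^^ i) y \<in> lev p"
    if "y \<in> lev p" for i y
  proof (induction i)
    case 0
    then show ?case using that by simp
  next
    case (Suc i)
    then show ?case using lev_pred_eq[of "(lev_pred p ^^ i) y" p] by auto
  qed
  have "approach x (- int k) = (lev_pred p ^^ k) (lev_pred p x)"
    unfolding approach_def Let_def p_def[symmetric] by (cases "k = 0") simp_all
  also have "\<dots> = (lev_pred p ^^ Suc k) x" by (simp only: funpow_Suc_right o_apply)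
  finally show ?thesis using *[OF x, of "Suc k"] by simp
qed

lemma approach_dyadic:
  assumes "x \<in> dyadic_rats" shows "approach x k \<in> dyadic_rats"
proof (cases "k \<ge> 0")
  case True
  have "x - ulp x * (1 / 2 ^ nat k) \<in> dyadic_rats"
    by (intro dyadic_diff dyadic_mult assms ulp_dyadic dyadic_inverse_power)
  then show ?thesis using approach_nonneg[OF assms, of "nat k"] True by simp
next
  case False
  have "((\<lambda>y. y - ulp y) ^^ i) x \<in> dyadic_rats" for i
    by (induction i) (auto intro: dyadic_diff ulp_dyadic assms)
  then have "approach x (- int (nat (- k))) \<in> dyadic_rats" unfolding approach_neg[OF assms] .
  then show ?thesis using False by simp
qed

text \<open>The two branches of the definition obey the same law, which determines the sequence from any
  of its tails.\<close>

lemma approach_step: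
  assumes x: "x \<in> dyadic_rats"
  shows "approach x k = approach x (k + 1) - ulp (approach x (k + 1))"
proof (cases "k \<ge> 0")
  case True
  then obtain n where k: "k = int n" using nonneg_int_cases by blast
  have e: "int n + 1 = int (Suc n)" by simp
  show ?thesis
    unfolding k e approach_nonneg[OF x] ulp_approach[OF x] by simp
next
  case False
  then obtain n where k: "k = - int (Suc n)" by (metis int_cases of_nat_0_le_iff)
  have e: "- int (Suc n) + 1 = - int n" by simp
  show ?thesis unfolding k e approach_neg[OF x] by simp
qed

section \<open>Recognising conjugates of the maps\<close>

text \<open>So the leftward steps of the sequence never shrink, which makes it unbounded below.\<close>

lemma ulp_step_ge:
  assumes "y \<in> dyadic_rats" shows "ulp y \<le> ulp (y - ulp y)"
proof -
  obtain a :: int where a: "y = of_int a * ulp y" using ulp_multiple[OF assms] by blast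
  define m where "m = (LEAST m. 2 ^ m * y \<in> \<int>)"
  have u: "ulp y = 1 / 2 ^ m" by (simp add: ulp_def m_def)
  have "y - ulp y = of_int (a - 1) * ulp y" using a by (simp add: algebra_simps)
  then have "2 ^ m * (y - ulp y) = of_int (a - 1)" by (simp add: u)
  then have "2 ^ m * (y - ulp y) \<in> \<int>" by (metis Ints_of_int)
  then show ?thesis using ulp_ge u by metis
qed

lemma approach_less_Suc:
  "x \<in> dyadic_rats \<Longrightarrow> approach x k < approach x (k + 1)"
  using approach_step[of x k] ulp_pos[of "approach x (k + 1)"] by linarith

lemma approach_mono:
  assumes x: "x \<in> dyadic_rats" and "k \<le> l" shows "approach x k \<le> approach x l"
  using assms(2)
proof (induction rule: int_ge_induct)
  case (step i)
  then show ?case using approach_less_Suc[OF x, of i] by simp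
qed simp

lemma approach_less:
  assumes x: "x \<in> dyadic_rats" shows "approach x k < x"
proof -
  have "approach x k \<le> approach x (int (nat k))" by (rule approach_mono[OF x]) simp
  also have "\<dots> < x" unfolding approach_nonneg[OF x] using ulp_pos[of x] by simp
  finally show ?thesis .
qed

lemma approach_unbounded:
  assumes x: "x \<in> dyadic_rats" shows "\<exists>n. approach x (- int n) \<le> t"
proof -
  have *: "approach x (- int n) \<le> x - of_nat n * ulp x \<and> ulp x \<le> ulp (approach x (- int n))" for n
  proof (induction n)
    case 0
    have "approach x 0 = x - ulp x" using approach_nonneg[OF x, of 0] by simp
    then show ?case using ulp_step_ge[OF x] ulp_pos[of x] by simp
  next
    case (Suc n)
    have "- int (Suc n) + 1 = - int n" by simp
    then have s: "approach x (- int (Suc n)) = approach x (- int n) - ulp (approach x (- int n))"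
      using approach_step[OF x, of "- int (Suc n)"] by simp
    show ?case unfolding s
      using Suc.IH ulp_step_ge[OF approach_dyadic[OF x], of "- int n"] by (simp add: algebra_simps)
  qed
  obtain n where "x - t < of_nat n * ulp x" using ulp_pos[of x] reals_Archimedean3 by blast
  then have "approach x (- int n) \<le> t" using *[of n] by linarith
  then show ?thesis ..
qed

lemma approach_covers:
  assumes x: "x \<in> dyadic_rats" and t: "t < x"
  shows "\<exists>k. approach x k \<le> t \<and> t < approach x (k + 1)"
proof -
  obtain m where m: "approach x (- int m) \<le> t" using approach_unbounded[OF x] by blast
  obtain n where n: "(1 / 2) ^ n < (x - t) / ulp x"
    using real_arch_pow_inv[of "(x - t) / ulp x" "1 / 2"] ulp_pos[of x] t by auto
  have "ulp x / 2 ^ n < x - t" using n ulp_pos[of x] by (simp add: field_simps power_divide)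
  then have n: "t < approach x (int n)" by (simp add: approach_nonneg[OF x])
  define P where "P j \<longleftrightarrow> t < approach x (- int m + int j)" for j
  have "P (m + n)" using n by (simp add: P_def)
  then have L: "P (Least P)" "\<And>j. j < Least P \<Longrightarrow> \<not> P j" by (auto intro: LeastI dest: not_less_Least)
  have "Least P \<noteq> 0" using L(1) m by (auto simp: P_def intro: ccontr)
  then obtain j where j: "Least P = Suc j" by (cases "Least P") auto
  have "\<not> P j" "P (Suc j)" using L j by auto
  then show ?thesis by (intro exI[of _ "- int m + int j"]) (simp add: P_def algebra_simps)
qed

lemma hmap_ge: "x \<le> t \<Longrightarrow> hmap x t = t"
  by (simp add: hmap_def)

text \<open>The parametrization avoids the division in the definition and covers both end points of
  each piece.\<close>

lemma hmap_piece:
  assumes x: "x \<in> dyadic_rats" and s: "0 \<le> s" "s \<le> 1"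
  shows "hmap x (approach x k + s * (approach x (k + 1) - approach x k))
    = approach x (k - 1) + s * (approach x k - approach x (k - 1))"
proof -
  have *: "hmap x (approach x k + s * (approach x (k + 1) - approach x k))
    = approach x (k - 1) + s * (approach x k - approach x (k - 1))"
    if s: "0 \<le> s" "s < 1" for k s
  proof -
    define t where "t = approach x k + s * (approach x (k + 1) - approach x k)"
    have pos: "0 < approach x (k + 1) - approach x k" using approach_less_Suc[OF x, of k] by simp
    have "s * (approach x (k + 1) - approach x k) < approach x (k + 1) - approach x k"
      using mult_strict_right_mono[OF s(2) pos] by simp
    then have t: "approach x k \<le> t" "t < approach x (k + 1)"
      using mult_nonneg_nonneg[OF s(1) less_imp_le[OF pos]]
      unfolding t_def by linarith+
    have u: "l = k" if l: "approach x l \<le> t" "t < approach x (l + 1)" for l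
    proof -
      have "\<not> l + 1 \<le> k" using approach_mono[OF x, of "l + 1" k] l t by linarith
      moreover have "\<not> k + 1 \<le> l" using approach_mono[OF x, of "k + 1" l] l t by linarith
      ultimately show ?thesis by linarith
    qed
    have the: "(THE l. approach x l \<le> t \<and> t < approach x (l + 1)) = k"
      using t u by (intro the_equality) blast+
    have "\<not> x \<le> t" using t approach_less[OF x, of "k + 1"] by linarith
    then show ?thesis using pos unfolding t_def[symmetric]
      by (simp add: hmap_def the Let_def) (simp add: t_def)
  qed
  show ?thesis
  proof (cases "s = 1")
    case True
    then show ?thesis using *[of 0 "k + 1"] by simp
  next
    case False
    then show ?thesis using * s by simp
  qed
qed

lemma hmap_point_cases:
  assumes x: "x \<in> dyadic_rats" and t: "t < x"
  obtains k s where "0 \<le> s" "s \<le> 1" "t = approach x k + s * (approach x (k + 1) - approach x k)"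
proof -
  obtain k where k: "approach x k \<le> t" "t < approach x (k + 1)" using approach_covers[OF x t] by blast
  have "0 < approach x (k + 1) - approach x k" using approach_less_Suc[OF x, of k] by simp
  then show thesis using k
    by (intro that[of "(t - approach x k) / (approach x (k + 1) - approach x k)" k])
      (simp_all add: field_simps)
qed

text \<open>A sequence whose steps are one unit is determined by any of its tails. A map that carries
  the ulp interval of each term affinely onto that of its image therefore matches two such sequences as soon as it does so far to the right.\<close>

lemma ulp_affine_sequence:
  fixes v w :: "int \<Rightarrow> real"
  assumes v: "\<And>k. v k = v (k + 1) - ulp (v (k + 1))" and w: "\<And>k. w k = w (k + 1) - ulp (w (k + 1))"
    and g: "\<And>k s. 0 \<le> s \<Longrightarrow> s \<le> 1 \<Longrightarrow> g (v k - s * ulp (v k)) = g (v k) - s * ulp (g (v k))"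
    and start: "\<And>k. k \<ge> K \<Longrightarrow> g (v k) = w k"
    and s: "0 \<le> s" "s \<le> 1"
  shows "g (v k + s * (v (k + 1) - v k)) = w k + s * (w (k + 1) - w k)"
proof -
  have gv: "g (v k) = w k" for k
  proof (cases "k \<ge> K")
    case False
    then have "k \<le> K" by simp
    then show ?thesis
    proof (induction rule: int_le_induct)
      case base
      then show ?case using start by simp
    next
      case (step i)
      have "v (i - 1) = v i - 1 * ulp (v i)" "w (i - 1) = w i - ulp (w i)"
        using v[of "i - 1"] w[of "i - 1"] by simp_all
      then show ?case using g[of 1 i] step.IH by simp
    qed
  qed (rule start)
  have vd: "ulp (v (k + 1)) = v (k + 1) - v k" and wd: "ulp (w (k + 1)) = w (k + 1) - w k"
    using v[of k] w[of k] by simp_all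
  have "v k + s * (v (k + 1) - v k) = v (k + 1) - (1 - s) * ulp (v (k + 1))"
    unfolding vd by (simp add: algebra_simps)
  also have "g \<dots> = w (k + 1) - (1 - s) * ulp (w (k + 1))"
    using g[of "1 - s" "k + 1"] s gv by simp
  also have "\<dots> = w k + s * (w (k + 1) - w k)" unfolding wd by (simp add: algebra_simps)
  finally show ?thesis .
qed

text \<open>A map that carries ulp intervals up to \<open>x\<close> affinely onto ulp intervals matches the sequence approaching \<open>x\<close> with the one
  approaching \<open>g x\<close> and is affine on its pieces, on which the homeomorphisms act by shifting the
  index.\<close>

lemma hmap_semiconj:
  assumes x: "x \<in> dyadic_rats" and gx: "g x \<in> dyadic_rats" and mono: "mono g"
    and g: "\<And>y s. y \<in> dyadic_rats \<Longrightarrow> y \<le> x \<Longrightarrow> 0 \<le> s \<Longrightarrow> s \<le> 1 \<Longrightarrow>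
      g (y - s * ulp y) = g y - s * ulp (g y)"
  shows "g (hmap x t) = hmap (g x) (g t)"
proof (cases "x \<le> t")
  case True
  then show ?thesis using monoD[OF mono True] by (simp add: hmap_ge)
next
  case False
  then obtain k s where s: "0 \<le> s" "s \<le> 1" and t: "t = approach x k + s * (approach x (k + 1) - approach x k)"
    using hmap_point_cases[OF x] by (metis not_le)
  have piece: "g (approach x k + s * (approach x (k + 1) - approach x k))
      = approach (g x) k + s * (approach (g x) (k + 1) - approach (g x) k)" for k
  proof (rule ulp_affine_sequence[where K = 0])
    show "approach x k = approach x (k + 1) - ulp (approach x (k + 1))" for k by (rule approach_step[OF x])
    show "approach (g x) k = approach (g x) (k + 1) - ulp (approach (g x) (k + 1))" for k
      by (rule approach_step[OF gx])
    show "g (approach x k - r * ulp (approach x k)) = g (approach x k) - r * ulp (g (approach x k))"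
      if "0 \<le> r" "r \<le> 1" for k r
      using that approach_less[OF x] approach_dyadic[OF x] by (intro g) (auto intro: less_imp_le)
    show "g (approach x k) = approach (g x) k" if "0 \<le> k" for k
      using approach_nonneg[OF x, of "nat k"] approach_nonneg[OF gx, of "nat k"]
        g[OF x, of "1 / 2 ^ nat k"] that by simp
  qed (fact s)+
  show ?thesis
    unfolding t hmap_piece[OF x s] piece hmap_piece[OF gx s] using piece[of "k - 1"] by simp
qed

text \<open>The homeomorphism attached to the integer \<open>n\<close>: identity from \<open>n\<close> on, doubling of the distance
  to \<open>n\<close> on \<open>[n - 1, n]\<close>, translation by \<open>-1\<close> further left.\<close>

definition stretch :: "real \<Rightarrow> real \<Rightarrow> real" where
  "stretch n t = t - min 1 (max 0 (n - t))"

lemma stretch_simps: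
  "t \<le> n - 1 \<Longrightarrow> stretch n t = t - 1"
  "n - 1 \<le> t \<Longrightarrow> t \<le> n \<Longrightarrow> stretch n t = 2 * t - n"
  "n \<le> t \<Longrightarrow> stretch n t = t"
  by (auto simp: stretch_def min_def max_def)

lemma stretch_mono: "mono (stretch n)"
  by (rule monoI) (auto simp: stretch_def min_def max_def)

lemma stretch_dyadic:
  assumes "n \<in> \<int>" "y \<in> dyadic_rats" shows "stretch n y \<in> dyadic_rats"
proof -
  have "y - 1 \<in> dyadic_rats" "2 * y - n \<in> dyadic_rats"
    using assms Ints_dyadic[of 1] Ints_dyadic[of 2] Ints_dyadic[of n]
    by (auto intro: dyadic_diff dyadic_mult)
  then show ?thesis using assms(2) by (auto simp: stretch_def min_def max_def)
qed

text \<open>Up to \<open>n - 1\<close> this is the invariance of units under integral translations. A point strictly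
  between \<open>n - 1\<close> and \<open>n\<close> is a fraction, so its ulp interval stays to the right of \<open>n - 1\<close>, where the
  map doubles lengths and units alike.\<close>

lemma stretch_ulp:
  assumes n: "n \<in> \<int>" and y: "y \<in> dyadic_rats" "y < n" and s: "0 \<le> s" "s \<le> 1"
  shows "stretch n (y - s * ulp y) = stretch n y - s * ulp (stretch n y)"
proof (cases "y \<le> n - 1")
  case True
  have "0 \<le> s * ulp y" using s ulp_pos[of y] by simp
  then have "y - s * ulp y \<le> n - 1" using True by simp
  then show ?thesis using True ulp_add_Ints[of "- 1" y] by (simp add: stretch_simps)
next
  case False
  have nint: "y \<notin> \<int>" using n False y by (auto elim!: Ints_cases)
  obtain a :: int and m where ym: "y = of_int a / 2 ^ m" and u: "ulp y = 1 / 2 ^ m"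
    using y(1)
  proof (cases rule: dyadic_cases)
    case int
    then show ?thesis using nint by simp
  next
    case (frac a m)
    then show ?thesis using that by blast
  qed
  obtain i where i: "n = of_int i" using n by (rule Ints_cases)
  have "of_int ((i - 1) * 2 ^ m) < (of_int a :: real)"
    using False i ym by (simp add: field_simps)
  then have "(i - 1) * 2 ^ m + 1 \<le> a" by (simp only: of_int_less_iff)
  then have "of_int ((i - 1) * 2 ^ m + 1) \<le> (of_int a :: real)" by (simp only: of_int_le_iff)
  then have "n - 1 \<le> y - ulp y" unfolding u unfolding i ym by (simp add: field_simps)
  moreover have "s * ulp y \<le> ulp y" "0 \<le> s * ulp y" using s ulp_pos[of y] by simp_all
  ultimately have "stretch n (y - s * ulp y) = 2 * (y - s * ulp y) - n"
    using y(2) by (intro stretch_simps) linarith+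
  moreover have "stretch n y = 2 * y - n" using y(2) False by (simp add: stretch_simps)
  moreover have "ulp (2 * y - n) = 2 * ulp y"
    using ulp_add_Ints[of "- n" "2 * y"] n ulp_double[OF y(1) nint]
    by simp
  ultimately show ?thesis by simp
qed

text \<open>The map \<open>stretch n\<close> carries ulp intervals below \<open>n\<close> onto ulp intervals and shifts the sequence approaching \<open>n\<close> by one index to the
  left, which is how \<open>hmap n\<close> is defined.\<close>

lemma hmap_Ints:
  assumes n: "n \<in> \<int>" shows "hmap n = stretch n"
proof
  fix t
  have nd: "n \<in> dyadic_rats" using n by (rule Ints_dyadic)
  show "hmap n t = stretch n t"
  proof (cases "n \<le> t")
    case True
    then show ?thesis by (simp add: hmap_ge stretch_simps)
  next
    case False
    then obtain k s where s: "0 \<le> s" "s \<le> 1" and t: "t = approach n k + s * (approach n (k + 1) - approach n k)"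
      using hmap_point_cases[OF nd] by (metis not_le)
    have "stretch n (approach n k + s * (approach n (k + 1) - approach n k))
      = approach n (k - 1) + s * (approach n ((k + 1) - 1) - approach n (k - 1))"
    proof (rule ulp_affine_sequence[where K = 1 and w = "\<lambda>k. approach n (k - 1)"])
      show "approach n k = approach n (k + 1) - ulp (approach n (k + 1))" for k by (rule approach_step[OF nd])
      show "approach n (k - 1) = approach n (k + 1 - 1) - ulp (approach n (k + 1 - 1))" for k
        using approach_step[OF nd, of "k - 1"] by simp
      show "stretch n (approach n k - r * ulp (approach n k))
          = stretch n (approach n k) - r * ulp (stretch n (approach n k))"
        if "0 \<le> r" "r \<le> 1" for k r
        using that approach_less[OF nd] approach_dyadic[OF nd] by (intro stretch_ulp n)
      show "stretch n (approach n k) = approach n (k - 1)" if "1 \<le> k" for k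
      proof -
        obtain j where j: "k = int (Suc j)" using \<open>1 \<le> k\<close> by (metis not0_implies_Suc nat_0_le nat_int zle_int le_numeral_extra(2) of_nat_0 of_nat_1 order_trans zero_le_one)
        have "k - 1 = int j" using j by simp
        have *: "approach n k = n - 1 / 2 ^ Suc j" "approach n (k - 1) = n - 1 / 2 ^ j"
          using approach_nonneg[OF nd, of "Suc j"] approach_nonneg[OF nd, of j] n j
          by (simp_all add: ulp_Ints)
        have "1 / 2 ^ Suc j \<le> (1 :: real)" by (simp del: power_Suc)
        then show ?thesis unfolding * by (subst stretch_simps(2)) (auto simp: field_simps)
      qed
    qed (fact s)+
    then show ?thesis unfolding t hmap_piece[OF nd s] by simp
  qed
qed

lemma hmap_conj_Ints:
  assumes x: "x \<in> dyadic_rats" "x < n" and n: "n \<in> \<int>"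
  shows "hmap n (hmap x t) = hmap (hmap n x) (hmap n t)"
  unfolding hmap_Ints[OF n] using x n
  by (intro hmap_semiconj stretch_mono stretch_dyadic stretch_ulp) auto

lemma hmap_translate:
  assumes x: "x \<in> dyadic_rats" and i: "i \<in> \<int>"
  shows "hmap (x + i) (t + i) = hmap x t + i"
  by (rule hmap_semiconj[of x "\<lambda>t. t + i" t, symmetric])
    (use assms in \<open>auto intro!: dyadic_add[OF _ Ints_dyadic] monoI simp: ulp_add_Ints\<close>)

text \<open>Between \<open>n - 1\<close> and \<open>n\<close> the map of \<open>n\<close> doubles the distance to \<open>n\<close>, so it halves the
  denominator of every fraction there. Together with \<open>hmap_conj_Ints\<close> this presents each \<open>hmap x\<close>
  as a conjugate of a simpler one.\<close>

lemma dyadic_hmap_induct [consumes 1, case_names Ints step]: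
  assumes "x \<in> dyadic_rats"
    and Ints: "\<And>x. x \<in> \<int> \<Longrightarrow> P x"
    and step: "\<And>x n. x \<in> dyadic_rats \<Longrightarrow> n \<in> \<int> \<Longrightarrow> n - 1 < x \<Longrightarrow> x < n \<Longrightarrow> P (hmap n x) \<Longrightarrow> P x"
  shows "P x"
proof -
  have "2 ^ m * x \<in> \<int> \<Longrightarrow> P x" for m
  proof (induction m arbitrary: x)
    case 0
    then show ?case using Ints by simp
  next
    case (Suc m)
    show ?case
    proof (cases "x \<in> \<int>")
      case False
      define n :: real where "n = of_int \<lceil>x\<rceil>"
      have n: "n \<in> \<int>" "n - 1 < x" "x \<le> n" unfolding n_def by (simp, linarith+)
      have "x < n" using n False by (metis order_less_le)
      have "2 ^ m * hmap n x = 2 ^ Suc m * x - 2 ^ m * n"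
        using n by (simp add: hmap_Ints stretch_simps algebra_simps)
      moreover have "\<dots> \<in> \<int>" using Suc.prems n(1) by (intro Ints_diff Ints_mult[OF _ n(1)]) auto
      ultimately have "P (hmap n x)" using Suc.IH by simp
      then show ?thesis using step[of x n] n \<open>x < n\<close> Suc.prems dyadic_iff by blast
    qed (rule Ints)
  qed
  then show ?thesis using assms(1) by (auto simp: dyadic_iff)
qed

section \<open>Piecewise linear dyadic maps and the conjugation rule\<close>

definition dyadic_affine :: "(real \<Rightarrow> real) \<Rightarrow> real \<Rightarrow> real \<Rightarrow> bool" where
  "dyadic_affine f s t \<longleftrightarrow>
     (\<exists>k :: int. \<exists>c\<in>dyadic_rats. \<forall>u\<in>{s..t}. f u = 2 powi k * u + c)"

text \<open>These maps form Thompson's group (\<open>thompson_maps_eq\<close>). Describing a map by a finite set of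
  points away from which it is affine, instead of by ordered lists of breakpoints and images, makes
  closure under composition and inversion direct. The dyadic offset of each affine piece replaces
  the requirement that breakpoints have dyadic images.\<close>

definition dyadic_pl :: "(real \<Rightarrow> real) set" where
  "dyadic_pl = {f. strict_mono f \<and> surj f \<and>
     (\<exists>B. finite B \<and> B \<subseteq> dyadic_rats \<and>
        (\<forall>s t. s < t \<longrightarrow> B \<inter> {s<..<t} = {} \<longrightarrow> dyadic_affine f s t)) \<and>
     (\<exists>L. \<exists>c\<in>\<int>. \<forall>t\<le>L. f t = t + c) \<and> (\<exists>L. \<exists>c\<in>\<int>. \<forall>t\<ge>L. f t = t + c)}"

lemma dyadic_plI:
  assumes "strict_mono f" "surj f" "finite B" "B \<subseteq> dyadic_rats"
    "\<And>s t. s < t \<Longrightarrow> B \<inter> {s<..<t} = {} \<Longrightarrow> dyadic_affine f s t"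
    "c \<in> \<int>" "\<And>t. t \<le> L \<Longrightarrow> f t = t + c" "d \<in> \<int>" "\<And>t. t \<ge> M \<Longrightarrow> f t = t + d"
  shows "f \<in> dyadic_pl"
  unfolding dyadic_pl_def using assms by blast

lemma dyadic_affineI:
  "c \<in> dyadic_rats \<Longrightarrow> (\<And>u. s \<le> u \<Longrightarrow> u \<le> t \<Longrightarrow> f u = 2 powi k * u + c) \<Longrightarrow> dyadic_affine f s t"
  unfolding dyadic_affine_def by (intro exI[of _ k] bexI[of _ c]) auto

lemma dyadic_pl_strict_mono: "f \<in> dyadic_pl \<Longrightarrow> strict_mono f"
  and dyadic_pl_surj: "f \<in> dyadic_pl \<Longrightarrow> surj f"
  by (auto simp: dyadic_pl_def)

lemma dyadic_pl_bij: "f \<in> dyadic_pl \<Longrightarrow> bij f"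
  by (simp add: bij_def dyadic_pl_strict_mono dyadic_pl_surj strict_mono_imp_inj_on)

text \<open>The affine pieces and their inverses have dyadic coefficients.\<close>

lemma dyadic_pl_dyadic_iff:
  assumes "f \<in> dyadic_pl" shows "f t \<in> dyadic_rats \<longleftrightarrow> t \<in> dyadic_rats"
proof -
  obtain B where B: "finite B" "\<And>s t. s < t \<Longrightarrow> B \<inter> {s<..<t} = {} \<Longrightarrow> dyadic_affine f s t"
    using assms unfolding dyadic_pl_def by blast
  \<comment> \<open>No exceptional point lies strictly between \<open>t\<close> and \<open>t'\<close>.\<close>
  define t' where "t' = Min (insert (t + 1) (B \<inter> {t<..}))"
  have fin: "finite (insert (t + 1) (B \<inter> {t<..}))" using B by simp
  have "t < t'" unfolding t'_def using fin by (subst Min_gr_iff) auto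
  moreover have "B \<inter> {t<..<t'} = {}"
    using Min_le[OF fin] unfolding t'_def by fastforce
  ultimately have "dyadic_affine f t t'" by (rule B)
  then obtain k :: int and c where c: "c \<in> dyadic_rats" "f t = 2 powi k * t + c"
    using \<open>t < t'\<close> unfolding dyadic_affine_def by fastforce
  have "t = 2 powi (- k) * (f t - c)" unfolding c(2) by (simp add: power_int_minus)
  then show ?thesis
    using c dyadic_add[OF dyadic_mult[OF dyadic_powi]] dyadic_mult[OF dyadic_powi dyadic_diff] by metis
qed

lemma dyadic_affine_comp:
  assumes "dyadic_affine f s t" "dyadic_affine g (f s) (f t)" "mono f"
  shows "dyadic_affine (g \<circ> f) s t"
proof -
  obtain k :: int and c where c: "c \<in> dyadic_rats" "\<forall>u\<in>{s..t}. f u = 2 powi k * u + c"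
    using assms(1) by (auto simp: dyadic_affine_def)
  obtain l :: int and d where d: "d \<in> dyadic_rats" "\<forall>u\<in>{f s..f t}. g u = 2 powi l * u + d"
    using assms(2) by (auto simp: dyadic_affine_def)
  show ?thesis
  proof (rule dyadic_affineI[where k = "l + k" and c = "2 powi l * c + d"])
    show "2 powi l * c + d \<in> dyadic_rats" by (intro dyadic_add dyadic_mult dyadic_powi c d)
    show "(g \<circ> f) u = 2 powi (l + k) * u + (2 powi l * c + d)" if u: "s \<le> u" "u \<le> t" for u
    proof -
      have "f u \<in> {f s..f t}" using u assms(3) by (auto dest: monoD)
      then have "g (f u) = 2 powi l * f u + d" using d by blast
      then show ?thesis using c u by (simp add: power_int_add algebra_simps)
    qed
  qed
qed

lemma dyadic_pl_comp:
  assumes f: "f \<in> dyadic_pl" and g: "g \<in> dyadic_pl" shows "g \<circ> f \<in> dyadic_pl"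
proof -
  obtain B c L d M where F: "strict_mono f" "surj f" "finite B" "B \<subseteq> dyadic_rats"
    "\<And>s t. s < t \<Longrightarrow> B \<inter> {s<..<t} = {} \<Longrightarrow> dyadic_affine f s t"
    "c \<in> \<int>" "\<And>t. t \<le> L \<Longrightarrow> f t = t + c" "d \<in> \<int>" "\<And>t. t \<ge> M \<Longrightarrow> f t = t + d"
    using f unfolding dyadic_pl_def by blast
  obtain B' c' L' d' M' where G: "strict_mono g" "surj g" "finite B'" "B' \<subseteq> dyadic_rats"
    "\<And>s t. s < t \<Longrightarrow> B' \<inter> {s<..<t} = {} \<Longrightarrow> dyadic_affine g s t"
    "c' \<in> \<int>" "\<And>t. t \<le> L' \<Longrightarrow> g t = t + c'" "d' \<in> \<int>" "\<And>t. t \<ge> M' \<Longrightarrow> g t = t + d'"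
    using g unfolding dyadic_pl_def by blast
  show ?thesis
  proof (rule dyadic_plI[where B = "B \<union> f -` B'" and c = "c + c'" and d = "d + d'"
        and L = "min L (L' - c)" and M = "max M (M' - d)"])
    show "strict_mono (g \<circ> f)" using F(1) G(1) by (simp add: strict_mono_def)
    show "surj (g \<circ> f)" using F(2) G(2) by (rule comp_surj)
    show "finite (B \<union> f -` B')"
      using F(3) finite_vimageI[OF G(3) strict_mono_imp_inj_on[OF F(1)]] by simp
    show "B \<union> f -` B' \<subseteq> dyadic_rats" using F(4) G(4) dyadic_pl_dyadic_iff[OF f] by auto
    show "dyadic_affine (g \<circ> f) s t" if st: "s < t" and e: "(B \<union> f -` B') \<inter> {s<..<t} = {}" for s t
    proof (rule dyadic_affine_comp)
      show "dyadic_affine f s t" using e by (intro F(5) st) auto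
      show "mono f" using F(1) by (rule strict_mono_mono)
      have "B' \<inter> {f s<..<f t} = {}"
      proof (rule ccontr)
        assume "B' \<inter> {f s<..<f t} \<noteq> {}"
        then obtain b where b: "b \<in> B'" "f s < b" "b < f t" by auto
        obtain u where u: "b = f u" using F(2) by (metis surjD)
        have "s < u" "u < t" using b u F(1) by (auto simp: strict_mono_less)
        then show False using e b u by auto
      qed
      then show "dyadic_affine g (f s) (f t)" using F(1) st by (intro G(5)) (auto simp: strict_mono_less)
    qed
    show "c + c' \<in> \<int>" "d + d' \<in> \<int>" using F G by auto
  qed (use F(7,9) G(7,9) in auto)
qed

lemma dyadic_pl_inv:
  assumes f: "f \<in> dyadic_pl" shows "inv_into UNIV f \<in> dyadic_pl"
proof -
  obtain B c L d M where F: "strict_mono f" "surj f" "finite B" "B \<subseteq> dyadic_rats"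
    "\<And>s t. s < t \<Longrightarrow> B \<inter> {s<..<t} = {} \<Longrightarrow> dyadic_affine f s t"
    "c \<in> \<int>" "\<And>t. t \<le> L \<Longrightarrow> f t = t + c" "d \<in> \<int>" "\<And>t. t \<ge> M \<Longrightarrow> f t = t + d"
    using f unfolding dyadic_pl_def by blast
  have inj: "inj f" using F(1) by (rule strict_mono_imp_inj_on)
  have fi: "f (inv_into UNIV f y) = y" for y using F(2) by (rule surj_f_inv_f)
  have less: "inv_into UNIV f a < inv_into UNIV f b \<longleftrightarrow> a < b" for a b
    using strict_mono_less[OF F(1), of "inv_into UNIV f a" "inv_into UNIV f b"] by (simp add: fi)
  show ?thesis
  proof (rule dyadic_plI[where B = "f ` B" and c = "- c" and d = "- d"
        and L = "L + c" and M = "M + d"])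
    show "strict_mono (inv_into UNIV f)" by (simp add: strict_mono_def less)
    show "surj (inv_into UNIV f)" using inj by (rule inj_imp_surj_inv)
    show "finite (f ` B)" using F(3) by simp
    show "f ` B \<subseteq> dyadic_rats" using F(4) dyadic_pl_dyadic_iff[OF f] by auto
    show "dyadic_affine (inv_into UNIV f) s t" if st: "s < t" and e: "f ` B \<inter> {s<..<t} = {}" for s t
    proof -
      have "f b \<in> {s<..<t}" if "b \<in> {inv_into UNIV f s<..<inv_into UNIV f t}" for b
        using that strict_mono_less[OF F(1)] fi by (metis greaterThanLessThan_iff)
      then have "B \<inter> {inv_into UNIV f s<..<inv_into UNIV f t} = {}" using e by blast
      then have "dyadic_affine f (inv_into UNIV f s) (inv_into UNIV f t)" using st by (intro F(5)) (simp add: less)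
      then obtain k :: int and a where a: "a \<in> dyadic_rats" "\<forall>u\<in>{inv_into UNIV f s..inv_into UNIV f t}. f u = 2 powi k * u + a"
        by (auto simp: dyadic_affine_def)
      show ?thesis
      proof (rule dyadic_affineI[where k = "- k" and c = "- (2 powi (- k) * a)"])
        show "- (2 powi (- k) * a) \<in> dyadic_rats" by (intro dyadic_minus dyadic_mult dyadic_powi a)
        fix u assume u: "s \<le> u" "u \<le> t"
        have "inv_into UNIV f s \<le> inv_into UNIV f u" "inv_into UNIV f u \<le> inv_into UNIV f t" using u less by (meson not_le)+
        then have "f (inv_into UNIV f u) = 2 powi k * inv_into UNIV f u + a" by (intro a(2)[rule_format]) simp
        then have "u = 2 powi k * inv_into UNIV f u + a" unfolding fi .
        then have "2 powi (- k) * (u - a) = 2 powi (- k) * (2 powi k * inv_into UNIV f u)" by simp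
        then show "inv_into UNIV f u = 2 powi - k * u + - (2 powi (- k) * a)"
          by (simp add: power_int_minus algebra_simps)
      qed
    qed
    show "- c \<in> \<int>" "- d \<in> \<int>" using F by auto
    show "inv_into UNIV f t = t + - c" if "t \<le> L + c" for t
      using F(7)[of "t - c"] that inv_f_f[OF inj, of "t - c"] by simp
    show "inv_into UNIV f t = t + - d" if "t \<ge> M + d" for t
      using F(9)[of "t - d"] that inv_f_f[OF inj, of "t - d"] by simp
  qed
qed

lemma dyadic_pl_translation:
  assumes i: "i \<in> \<int>" shows "(\<lambda>t. t + i) \<in> dyadic_pl"
proof (rule dyadic_plI[where B = "{}" and c = i and d = i])
  show "dyadic_affine (\<lambda>t. t + i) s t" for s t
    by (rule dyadic_affineI[where k = 0 and c = i]) (auto simp: Ints_dyadic i)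
  show "surj (\<lambda>t. t + i)" by (rule surjI[of _ "\<lambda>t. t - i"]) simp
qed (auto simp: strict_mono_def i)

lemma dyadic_pl_stretch:
  assumes n: "n \<in> \<int>" shows "stretch n \<in> dyadic_pl"
proof (rule dyadic_plI[where B = "{n - 1, n}" and c = "- 1" and d = 0 and L = "n - 1" and M = n])
  show "strict_mono (stretch n)" by (rule strict_monoI) (auto simp: stretch_def min_def max_def)
  show "surj (stretch n)"
    by (rule surjI[of _ "\<lambda>t. if n \<le> t then t else if n - 2 \<le> t then (t + n) / 2 else t + 1"])
      (auto simp: stretch_def min_def max_def field_simps)
  show "{n - 1, n} \<subseteq> dyadic_rats" using n by (auto intro: Ints_dyadic)
  show "dyadic_affine (stretch n) s t" if "s < t" "{n - 1, n} \<inter> {s<..<t} = {}" for s t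
  proof -
    have "n - 1 \<le> s \<or> t \<le> n - 1" "n \<le> s \<or> t \<le> n"
      using that(2) by (auto simp: Int_insert_left split: if_splits)
    then consider "t \<le> n - 1" | "n - 1 \<le> s" "t \<le> n" | "n \<le> s" by blast
    then show ?thesis
    proof cases
      case 1
      then show ?thesis
        by (intro dyadic_affineI[where k = 0 and c = "- 1"]) (auto simp: Ints_dyadic stretch_simps)
    next
      case 2
      then show ?thesis using n
        by (intro dyadic_affineI[where k = 1 and c = "- n"]) (auto simp: Ints_dyadic stretch_simps)
    next
      case 3
      then show ?thesis
        by (intro dyadic_affineI[where k = 0 and c = 0]) (auto simp: Ints_dyadic stretch_simps)
    qed
  qed
qed (auto simp: stretch_simps)

lemma dyadic_pl_hmap: "x \<in> dyadic_rats \<Longrightarrow> hmap x \<in> dyadic_pl"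
proof (induction x rule: dyadic_hmap_induct)
  case (Ints x)
  then show ?case by (simp add: hmap_Ints dyadic_pl_stretch)
next
  case (step x n)
  have n: "hmap n \<in> dyadic_pl" using step by (simp add: hmap_Ints dyadic_pl_stretch)
  have "hmap x = inv_into UNIV (hmap n) \<circ> (hmap (hmap n x) \<circ> hmap n)"
  proof
    fix t
    show "hmap x t = (inv_into UNIV (hmap n) \<circ> (hmap (hmap n x) \<circ> hmap n)) t"
      using inv_f_f[OF bij_is_inj[OF dyadic_pl_bij[OF n]], of "hmap x t"]
      by (simp add: hmap_conj_Ints[OF step(1,4,2)])
  qed
  then show ?case using n step.IH by (simp only: dyadic_pl_comp dyadic_pl_inv)
qed

lemma hmap_less_iff: "x \<in> dyadic_rats \<Longrightarrow> hmap x s < hmap x t \<longleftrightarrow> s < t"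
  by (rule strict_mono_less[OF dyadic_pl_strict_mono[OF dyadic_pl_hmap]])

lemma hmap_inj: "x \<in> dyadic_rats \<Longrightarrow> hmap x s = hmap x t \<longleftrightarrow> s = t"
  by (rule strict_mono_eq[OF dyadic_pl_strict_mono[OF dyadic_pl_hmap]])

lemma hmap_dyadic_iff: "x \<in> dyadic_rats \<Longrightarrow> hmap x t \<in> dyadic_rats \<longleftrightarrow> t \<in> dyadic_rats"
  by (rule dyadic_pl_dyadic_iff[OF dyadic_pl_hmap])

lemma hmap_less_fixpoint: "x \<in> dyadic_rats \<Longrightarrow> hmap x t < x \<longleftrightarrow> t < x"
  using hmap_less_iff[of x t x] hmap_ge[of x x] by simp

text \<open>The general conjugation rule. Conjugating by \<open>h\<^sub>n\<close>, where \<open>n\<close> is the next integer above \<open>x\<close>,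
  moves both \<open>x\<close> and \<open>y\<close>, and the rule for the moved points implies the one for \<open>x\<close> and \<open>y\<close>, as \<open>h\<^sub>n\<close>
  is injective.\<close>

theorem hmap_conj:
  assumes "x \<in> dyadic_rats"
  shows "y \<in> dyadic_rats \<Longrightarrow> y < x \<Longrightarrow> hmap x (hmap y t) = hmap (hmap x y) (hmap x t)"
  using assms
proof (induction x arbitrary: y t rule: dyadic_hmap_induct)
  case (Ints x)
  then show ?case by (simp add: hmap_conj_Ints)
next
  case (step x n)
  define g where "g = hmap n"
  have gd: "n \<in> dyadic_rats" using step(2) by (rule Ints_dyadic)
  have conj: "g (hmap z s) = hmap (g z) (g s)" if "z \<in> dyadic_rats" "z < n" for z s
    using hmap_conj_Ints[OF that step(2)] by (simp add: g_def)
  have y: "y < n" "g y < g x" "g y \<in> dyadic_rats"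
    using step.prems step(4) hmap_less_iff[OF gd] hmap_dyadic_iff[OF gd] by (auto simp: g_def)
  have hy: "hmap x y \<in> dyadic_rats" "hmap x y < n"
    using step.prems step(1,4) hmap_dyadic_iff[OF step(1)] hmap_less_fixpoint[OF step(1), of y] by auto
  have "g (hmap x (hmap y t)) = hmap (g x) (g (hmap y t))" by (rule conj[OF step(1,4)])
  also have "\<dots> = hmap (g x) (hmap (g y) (g t))" using conj step.prems y by simp
  also have "\<dots> = hmap (hmap (g x) (g y)) (hmap (g x) (g t))"
    using step.IH[of "g y" "g t"] y by (simp add: g_def)
  also have "\<dots> = hmap (g (hmap x y)) (g (hmap x t))" by (simp add: conj[OF step(1,4)])
  also have "\<dots> = g (hmap (hmap x y) (hmap x t))" by (rule conj[OF hy, symmetric])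
  finally show ?case using hmap_inj[OF gd] by (simp add: g_def)
qed

lemma hmap_descends:
  assumes "x \<in> dyadic_rats" shows "t < x \<Longrightarrow> hmap x t < t"
  using assms
proof (induction x arbitrary: t rule: dyadic_hmap_induct)
  case (Ints x)
  then show ?case by (simp add: hmap_Ints stretch_def)
next
  case (step x n)
  have gd: "n \<in> dyadic_rats" using step(2) by (rule Ints_dyadic)
  have "hmap (hmap n x) (hmap n t) < hmap n t" using step.IH step.prems hmap_less_iff[OF gd] by simp
  then show ?case using hmap_conj_Ints[OF step(1,4,2)] hmap_less_iff[OF gd] by metis
qed

text \<open>Far to the left the conjugating maps \<open>h\<^sub>n\<close> are translations, so they commute with the
  translation by \<open>-1\<close>.\<close>

lemma hmap_unit_translation:
  assumes "x \<in> dyadic_rats" shows "\<exists>L. \<forall>t\<le>L. hmap x t = t - 1"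
  using assms
proof (induction x rule: dyadic_hmap_induct)
  case (Ints x)
  then show ?case by (auto simp: hmap_Ints stretch_simps intro!: exI[of _ "x - 1"])
next
  case (step x n)
  have gd: "n \<in> dyadic_rats" using step(2) by (rule Ints_dyadic)
  obtain L where L: "\<forall>t\<le>L. hmap (hmap n x) t = t - 1" using step.IH by blast
  have tr: "hmap n t = t - 1" if "t \<le> n - 1" for t using that by (simp add: hmap_Ints[OF step(2)] stretch_simps)
  have "hmap x t = t - 1" if t: "t \<le> min L (n - 1)" for t
  proof -
    have "hmap n (hmap x t) = t - 1 - 1"
      using hmap_conj_Ints[OF step(1,4,2), of t] L t tr by simp
    also have "\<dots> = hmap n (t - 1)" using t tr by simp
    finally show ?thesis using hmap_inj[OF gd] by simp
  qed
  then show ?case by blast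
qed

text \<open>For an integer \<open>x\<close> every application lowers \<open>t\<close> by at least the smaller of 1 and the
  initial distance to \<open>x\<close>; conjugation by \<open>h\<^sub>n\<close> preserves unboundedness.\<close>

lemma hmap_iterates_unbounded:
  assumes "x \<in> dyadic_rats" shows "t < x \<Longrightarrow> \<exists>k. (hmap x ^^ k) t \<le> c"
  using assms
proof (induction x arbitrary: t c rule: dyadic_hmap_induct)
  case (Ints x)
  have "(hmap x ^^ k) t \<le> t - of_nat k * min 1 (x - t)" for k
  proof (induction k)
    case (Suc k)
    define s where "s = (hmap x ^^ k) t"
    have "0 \<le> of_nat k * min 1 (x - t)" using Ints by simp
    then have "s \<le> t" using Suc by (simp add: s_def)
    then have "hmap x s \<le> s - min 1 (x - t)" using Ints by (auto simp: hmap_Ints stretch_def min_def max_def)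
    then show ?case using Suc by (simp add: s_def[symmetric] algebra_simps)
  qed simp
  moreover obtain k where "t - c < of_nat k * min 1 (x - t)"
    using reals_Archimedean3[of "min 1 (x - t)"] Ints by auto
  ultimately show ?case by (smt (verit))
next
  case (step x n)
  have gd: "n \<in> dyadic_rats" using step(2) by (rule Ints_dyadic)
  have it: "hmap n ((hmap x ^^ k) t) = (hmap (hmap n x) ^^ k) (hmap n t)" for k
    by (induction k) (simp_all add: hmap_conj_Ints[OF step(1,4,2)])
  obtain k where "(hmap (hmap n x) ^^ k) (hmap n t) \<le> hmap n c"
    using step.IH step.prems hmap_less_iff[OF gd] by blast
  then have "(hmap x ^^ k) t \<le> c"
    using it[of k] hmap_less_iff[OF gd] by (metis not_le)
  then show ?case ..
qed

lemma homeomorphism_strict_mono: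
  fixes f :: "real \<Rightarrow> real"
  assumes "strict_mono f" "surj f" shows "homeomorphism UNIV UNIV f (inv_into UNIV f)"
proof -
  have fi: "f (inv_into UNIV f y) = y" for y using assms(2) by (rule surj_f_inv_f)
  have inj: "inj f" using assms(1) by (rule strict_mono_imp_inj_on)
  have le: "inv_into UNIV f a \<le> inv_into UNIV f b" if "a \<le> b" for a b
    using strict_mono_less_eq[OF assms(1), of "inv_into UNIV f a" "inv_into UNIV f b"] that by (simp add: fi)
  have "continuous_on UNIV f"
    using assms by (intro continuous_onI_mono) (auto simp: strict_mono_less_eq)
  moreover have "continuous_on UNIV (inv_into UNIV f)"
    using le inj_imp_surj_inv[OF inj] by (intro continuous_onI_mono) auto
  ultimately show ?thesis
    using assms(2) inj inj_imp_surj_inv[OF inj] by (auto simp: homeomorphism_def fi)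
qed

lemma thompson_maps_subset: "thompson_maps \<subseteq> dyadic_pl"
proof
  fix f assume "f \<in> thompson_maps"
  then have sm: "strict_mono f" and hom: "\<exists>g. homeomorphism UNIV UNIV f g"
    by (simp_all add: thompson_maps_def)
  from \<open>f \<in> thompson_maps\<close> obtain n :: nat and u v :: "nat \<Rightarrow> real" where
    D: "\<forall>i\<le>n. u i \<in> dyadic_rats \<and> v i \<in> dyadic_rats"
    and piece: "\<forall>i<n. \<forall>t\<in>{u i..u (Suc i)}.
           f t = v i + (v (Suc i) - v i) / (u (Suc i) - u i) * (t - u i)"
    and slope: "\<forall>i<n. \<exists>k :: int. (v (Suc i) - v i) / (u (Suc i) - u i) = 2 powi k"
    and left: "\<forall>t\<le>u 0. f t = t + v 0 - u 0" "v 0 - u 0 \<in> \<int>"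
    and right: "\<forall>t\<ge>u n. f t = t + v n - u n" "v n - u n \<in> \<int>"
    unfolding thompson_maps_def by (elim CollectE conjE exE) (rule that)
  show "f \<in> dyadic_pl"
  proof (rule dyadic_plI[where B = "u ` {..n}" and c = "v 0 - u 0" and d = "v n - u n"])
    show "surj f" using hom by (auto simp: homeomorphism_def)
    show "u ` {..n} \<subseteq> dyadic_rats" using D by auto
    fix s t :: real assume st: "s < t" and e: "u ` {..n} \<inter> {s<..<t} = {}"
    have out: "u i \<le> s \<or> t \<le> u i" if "i \<le> n" for i using e that by fastforce
    consider "t \<le> u 0" | "u n \<le> s" | "u 0 \<le> s" "s < u n" using out[of 0] by linarith
    then show "dyadic_affine f s t"
    proof cases
      case 1
      then show ?thesis
        by (intro dyadic_affineI[where k = 0 and c = "v 0 - u 0"]) (use D left(1) in \<open>auto intro: dyadic_diff\<close>)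
    next
      case 2
      then show ?thesis
        by (intro dyadic_affineI[where k = 0 and c = "v n - u n"]) (use D right(1) in \<open>auto intro: dyadic_diff\<close>)
    next
      case 3
      then obtain i where i: "i < n" "u i \<le> s" "s < u (Suc i)"
        using ex_least_nat_less[of "\<lambda>i. s < u i" n] by (auto simp: not_less)
      obtain k :: int where k: "(v (Suc i) - v i) / (u (Suc i) - u i) = 2 powi k"
        using slope i(1) by blast
      have t: "t \<le> u (Suc i)" using out[of "Suc i"] i by linarith
      show ?thesis
      proof (rule dyadic_affineI[where k = k and c = "v i - 2 powi k * u i"])
        show "v i - 2 powi k * u i \<in> dyadic_rats"
          using D i by (intro dyadic_diff dyadic_mult dyadic_powi) auto
        show "f w = 2 powi k * w + (v i - 2 powi k * u i)" if "s \<le> w" "w \<le> t" for w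
          using piece[rule_format, OF i(1), of w] that i t by (simp add: k algebra_simps)
      qed
    qed
  qed (use sm left right in \<open>auto simp: algebra_simps\<close>)
qed

text \<open>Breakpoints are the exceptional points of the map and one integer in each of the two
  regions of translation, in increasing order.\<close>

lemma dyadic_pl_subset: "dyadic_pl \<subseteq> thompson_maps"
proof
  fix f assume "f \<in> dyadic_pl"
  then obtain B c L d M where F: "strict_mono f" "surj f" "finite B" "B \<subseteq> dyadic_rats"
    "\<And>s t. s < t \<Longrightarrow> B \<inter> {s<..<t} = {} \<Longrightarrow> dyadic_affine f s t"
    "c \<in> \<int>" "\<And>t. t \<le> L \<Longrightarrow> f t = t + c" "d \<in> \<int>" "\<And>t. t \<ge> M \<Longrightarrow> f t = t + d"
    unfolding dyadic_pl_def by blast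
  define C where "C = insert (of_int \<lfloor>L\<rfloor>) (insert (of_int \<lceil>M\<rceil>) B)"
  have C: "finite C" "C \<subseteq> dyadic_rats" using F(3,4) by (auto simp: C_def Ints_dyadic)
  define xs where "xs = sorted_list_of_set C"
  have xs: "sorted_wrt (<) xs" "set xs = C" using C by (simp_all add: xs_def)
  define n where "n = length xs - 1"
  have "xs \<noteq> []" using xs(2) by (auto simp: C_def)
  then have len: "length xs = Suc n" by (cases xs) (simp_all add: n_def)
  define u where "u = (\<lambda>i. xs ! i)"
  have uC: "u i \<in> C" if "i \<le> n" for i using that len xs(2) nth_mem[of i xs] by (simp add: u_def)
  have mono: "u i < u j" if "i < j" "j \<le> n" for i j
    using sorted_wrt_nth_less[OF xs(1), of i j] that len by (simp add: u_def)
  have mono': "u i \<le> u j" if "i \<le> j" "j \<le> n" for i j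
    using mono[of i j] that by (cases "i = j") auto
  have uex: "\<exists>j\<le>n. b = u j" if "b \<in> C" for b
    using that xs(2) len by (auto simp: u_def in_set_conv_nth less_Suc_eq_le)
  have u0: "u 0 \<le> L"
  proof -
    obtain j where "j \<le> n" "of_int \<lfloor>L\<rfloor> = u j" using uex[of "of_int \<lfloor>L\<rfloor>"] by (auto simp: C_def)
    then show ?thesis using mono'[of 0 j] by linarith
  qed
  have un: "M \<le> u n"
  proof -
    obtain j where "j \<le> n" "of_int \<lceil>M\<rceil> = u j" using uex[of "of_int \<lceil>M\<rceil>"] by (auto simp: C_def)
    then show ?thesis using mono'[of j n] by linarith
  qed
  have piece: "\<exists>k :: int. (f (u (Suc i)) - f (u i)) / (u (Suc i) - u i) = 2 powi k \<and>
      (\<forall>t\<in>{u i..u (Suc i)}. f t = f (u i) + (f (u (Suc i)) - f (u i)) / (u (Suc i) - u i) * (t - u i))"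
    if i: "i < n" for i
  proof -
    have lt: "u i < u (Suc i)" using mono[of i "Suc i"] i by simp
    have "B \<inter> {u i<..<u (Suc i)} = {}"
    proof (rule ccontr)
      assume "B \<inter> {u i<..<u (Suc i)} \<noteq> {}"
      then obtain b where "b \<in> B" and b: "u i < b" "b < u (Suc i)" by auto
      then have "b \<in> C" by (simp add: C_def)
      obtain j where j: "j \<le> n" "b = u j" using uex[OF \<open>b \<in> C\<close>] by blast
      have "i < j" "j < Suc i" using b j i mono'[of j i] mono'[of "Suc i" j] by (meson leI less_imp_le not_le)+
      then show False by simp
    qed
    then have "dyadic_affine f (u i) (u (Suc i))" by (rule F(5)[OF lt])
    then obtain k :: int and a where "\<forall>t\<in>{u i..u (Suc i)}. f t = 2 powi k * t + a"
      by (auto simp: dyadic_affine_def)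
    then have ft: "f t = 2 powi k * t + a" if "u i \<le> t" "t \<le> u (Suc i)" for t using that by simp
    have sl: "(f (u (Suc i)) - f (u i)) / (u (Suc i) - u i) = 2 powi k"
      using ft[of "u i"] ft[of "u (Suc i)"] lt by (simp add: field_simps)
    show ?thesis unfolding sl using ft ft[of "u i"] lt by (intro exI[of _ k]) (auto simp: algebra_simps)
  qed
  have "\<exists>g. homeomorphism UNIV UNIV f g" using homeomorphism_strict_mono[OF F(1,2)] by blast
  moreover have "\<forall>i\<le>n. u i \<in> dyadic_rats \<and> f (u i) \<in> dyadic_rats"
    using uC C(2) dyadic_pl_dyadic_iff[OF \<open>f \<in> dyadic_pl\<close>] by blast
  moreover have "\<forall>i<n. u i < u (Suc i) \<and> f (u i) < f (u (Suc i))"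
    using mono F(1) by (auto simp: strict_mono_less)
  moreover have "\<forall>i<n. \<forall>t\<in>{u i..u (Suc i)}.
      f t = f (u i) + (f (u (Suc i)) - f (u i)) / (u (Suc i) - u i) * (t - u i)"
    "\<forall>i<n. \<exists>k :: int. (f (u (Suc i)) - f (u i)) / (u (Suc i) - u i) = 2 powi k"
    using piece by blast+
  moreover have "\<forall>t\<le>u 0. f t = t + f (u 0) - u 0" "f (u 0) - u 0 \<in> \<int>"
    using F(6,7) u0 by auto
  moreover have "\<forall>t\<ge>u n. f t = t + f (u n) - u n" "f (u n) - u n \<in> \<int>"
    using F(8,9) un by auto
  ultimately show "f \<in> thompson_maps"
    unfolding thompson_maps_def using F(1)
    by (intro CollectI conjI exI[of _ n] exI[of _ u] exI[of _ "\<lambda>i. f (u i)"]) assumption+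
qed

lemma thompson_maps_eq: "thompson_maps = dyadic_pl"
  using thompson_maps_subset dyadic_pl_subset by blast

section \<open>The trickle graph axioms\<close>

lemma dyadic_trickle_simps [simp]:
  "verts dyadic_trickle = dyadic_verts"
  "po dyadic_trickle = (\<le>)"
  "label dyadic_trickle a = \<infinity>"
  by (simp_all add: dyadic_trickle_def)

lemma edge_iff [simp]:
  "{a, b} \<in> edges dyadic_trickle \<longleftrightarrow> a \<in> dyadic_verts \<and> b \<in> dyadic_verts \<and> a \<noteq> b"
  by (auto simp: dyadic_trickle_def doubleton_eq_iff)

lemma dyadic_vert_cases:
  assumes "a \<in> dyadic_verts"
  obtains (fin) y where "y \<in> dyadic_rats" "a = ereal y" | (inf) "a = \<infinity>"
  using assms by (auto simp: dyadic_verts_def)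

lemma dyadic_vert_simps [simp]: "ereal y \<in> dyadic_verts \<longleftrightarrow> y \<in> dyadic_rats" "\<infinity> \<in> dyadic_verts"
  by (auto simp: dyadic_verts_def)

abbreviation act :: "ereal \<Rightarrow> ereal \<Rightarrow> ereal" where
  "act \<equiv> aut dyadic_trickle"

lemma act_simps [simp]: "act a \<infinity> = \<infinity>" "act a (ereal y) = ereal (hmap_ext a y)"
  by (simp_all add: dyadic_trickle_def)

lemma hmap_ext_simps [simp]: "hmap_ext \<infinity> t = t - 1" "hmap_ext (ereal y) = hmap y"
  by (simp_all add: hmap_ext_def fun_eq_iff)

lemma hmap_ext_pl:
  assumes "a \<in> dyadic_verts" shows "hmap_ext a \<in> dyadic_pl"
  using assms
proof (cases rule: dyadic_vert_cases)
  case inf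
  have "hmap_ext \<infinity> = (\<lambda>t. t + - 1)" by auto
  then show ?thesis using dyadic_pl_translation[of "- 1"] inf by (simp del: hmap_ext_simps)
qed (auto simp: dyadic_pl_hmap)

lemma hmap_ext_bij: "a \<in> dyadic_verts \<Longrightarrow> bij (hmap_ext a)"
  by (rule dyadic_pl_bij[OF hmap_ext_pl])

lemma hmap_ext_ge: "a \<le> ereal t \<Longrightarrow> a \<noteq> - \<infinity> \<Longrightarrow> hmap_ext a t = t"
  by (cases a) (auto simp: hmap_ge)

lemma hmap_ext_descends: "a \<in> dyadic_verts \<Longrightarrow> ereal t < a \<Longrightarrow> hmap_ext a t < t"
  by (cases rule: dyadic_vert_cases) (auto simp: hmap_descends)

lemma act_le_iff:
  assumes "a \<in> dyadic_verts" "b \<in> dyadic_verts" "c \<in> dyadic_verts"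
  shows "act a b \<le> act a c \<longleftrightarrow> b \<le> c"
  using assms strict_mono_less_eq[OF dyadic_pl_strict_mono[OF hmap_ext_pl[OF assms(1)]]]
  by (auto elim!: dyadic_vert_cases)

lemma act_inj:
  assumes "a \<in> dyadic_verts" "b \<in> dyadic_verts" "c \<in> dyadic_verts"
  shows "act a b = act a c \<longleftrightarrow> b = c"
  using act_le_iff[OF assms] act_le_iff[OF assms(1,3,2)] by (auto simp: order_eq_iff)

lemma act_vert: "a \<in> dyadic_verts \<Longrightarrow> b \<in> dyadic_verts \<Longrightarrow> act a b \<in> dyadic_verts"
  using dyadic_pl_dyadic_iff[OF hmap_ext_pl] by (auto elim!: dyadic_vert_cases[of b])

lemma act_surj:
  assumes "a \<in> dyadic_verts" "b \<in> dyadic_verts" obtains c where "c \<in> dyadic_verts" "act a c = b"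
  using assms(2)
proof (cases rule: dyadic_vert_cases)
  case (fin y)
  obtain t where t: "y = hmap_ext a t"
    using dyadic_pl_surj[OF hmap_ext_pl[OF assms(1)]] by (metis surjD)
  then have "t \<in> dyadic_rats" using fin dyadic_pl_dyadic_iff[OF hmap_ext_pl[OF assms(1)]] by simp
  then show ?thesis using that[of "ereal t"] fin t by simp
next
  case inf
  then show ?thesis using that[of \<infinity>] by simp
qed

lemma act_ge: "a \<in> dyadic_verts \<Longrightarrow> b \<in> dyadic_verts \<Longrightarrow> a \<le> b \<Longrightarrow> act a b = b"
  by (auto elim!: dyadic_vert_cases simp: hmap_ge)

lemma act_less_iff:
  assumes "a \<in> dyadic_verts" "b \<in> dyadic_verts" shows "act a b < a \<longleftrightarrow> b < a"
  using act_le_iff[OF assms(1,1,2)] act_ge[OF assms(1,1)] by (simp add: not_le[symmetric])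

lemma hmap_ext_conj:
  assumes "a \<in> dyadic_verts" "b \<in> dyadic_verts" "b < a"
  shows "hmap_ext a (hmap_ext b t) = hmap_ext (act a b) (hmap_ext a t)"
  using assms hmap_translate[of _ "- 1" t] by (auto elim!: dyadic_vert_cases simp: hmap_conj)

lemma act_conj:
  assumes "a \<in> dyadic_verts" "b \<in> dyadic_verts" "b < a" "c \<in> dyadic_verts"
  shows "act a (act b c) = act (act a b) (act a c)"
  using assms(4) hmap_ext_conj[OF assms(1-3)] by (auto elim!: dyadic_vert_cases[of c])

lemma star_complete: "a \<in> dyadic_verts \<Longrightarrow> star dyadic_trickle a = dyadic_verts"
  by (auto simp: star_def)

lemma trickle_graph_dyadic: "trickle_graph dyadic_trickle"
  unfolding trickle_graph_def
proof (intro conjI ballI allI impI)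
  show "edges dyadic_trickle \<subseteq> {{x, y} |x y. x \<in> verts dyadic_trickle \<and> y \<in> verts dyadic_trickle \<and> x \<noteq> y}"
    by (simp add: dyadic_trickle_def)
  show "partial_order_on (verts dyadic_trickle)
     {(x, y). x \<in> verts dyadic_trickle \<and> y \<in> verts dyadic_trickle \<and> po dyadic_trickle x y}"
    by (auto simp: partial_order_on_def preorder_on_def refl_on_def trans_def antisym_def)
next
  fix a assume a: "a \<in> verts dyadic_trickle"
  then have a': "a \<in> dyadic_verts" by simp
  show "2 \<le> label dyadic_trickle a" by simp
  show "bij_betw (act a) (star dyadic_trickle a) (star dyadic_trickle a)"
    unfolding star_complete[OF a']
  proof (rule bij_betw_imageI)
    show "inj_on (act a) dyadic_verts" by (rule inj_onI) (simp add: act_inj[OF a'])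
    show "act a ` dyadic_verts = dyadic_verts"
      using act_vert[OF a'] by (auto elim: act_surj[OF a'])
  qed
  fix b assume "b \<in> star dyadic_trickle a"
  then have b: "b \<in> dyadic_verts" by (simp add: star_def)
  show "po_strict dyadic_trickle b a" if "act a b \<noteq> b"
  proof -
    have "b < a" using act_ge[OF a' b] that by (metis not_le)
    then show ?thesis by (auto simp: po_strict_def)
  qed
  show "label dyadic_trickle (act a b) = label dyadic_trickle b" by simp
  fix c assume "c \<in> star dyadic_trickle a"
  then have c: "c \<in> dyadic_verts" by (simp add: star_def)
  show "({act a b, act a c} \<in> edges dyadic_trickle) = ({b, c} \<in> edges dyadic_trickle)"
    using a' b c act_vert act_inj by simp
  show "po dyadic_trickle c b = po dyadic_trickle (act a c) (act a b)"
    using a' b c act_le_iff by simp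
next
  fix a b assume "a \<in> verts dyadic_trickle" "b \<in> verts dyadic_trickle" "po_strict dyadic_trickle a b"
  then show "{a, b} \<in> edges dyadic_trickle" by (simp add: po_strict_def)
next
  fix a b c assume "{a, b} \<in> par_edges dyadic_trickle \<and> po dyadic_trickle c b"
  then show "{a, c} \<in> par_edges dyadic_trickle" by (auto simp: par_edges_def)
next
  fix a m assume "label dyadic_trickle a = enat m"
  then show "\<exists>d>0. d dvd m \<and> (\<forall>y\<in>star dyadic_trickle a. (act a ^^ d) y = y) \<and>
      (\<forall>e. 0 < e \<and> e < d \<longrightarrow> (\<exists>y\<in>star dyadic_trickle a. (act a ^^ e) y \<noteq> y))" by simp
next
  fix a b c assume "a \<in> verts dyadic_trickle" "b \<in> verts dyadic_trickle" "c \<in> verts dyadic_trickle"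
    "po_strict dyadic_trickle c b \<and> po_strict dyadic_trickle b a"
  then show "act a (act b c) = act (act a b) (act a c)"
    by (intro act_conj) (auto simp: po_strict_def)
qed

text \<open>An automorphism \<open>act a\<close> with \<open>a \<le> x\<close> moves only vertices below \<open>a\<close>, and keeps them below \<open>a\<close>.\<close>

lemma parabolic_below: "parabolic dyadic_trickle (below x)"
  unfolding parabolic_def
proof (intro conjI ballI)
  show "below x \<subseteq> verts dyadic_trickle" by (auto simp: below_def)
  fix a assume a: "a \<in> below x"
  then have a': "a \<in> dyadic_verts" by (simp add: below_def)
  have star: "star (full_subgraph dyadic_trickle (below x)) a = below x"
    using a by (auto simp: star_def full_subgraph_def below_def)
  have le: "act a b \<le> ereal x \<longleftrightarrow> b \<le> ereal x" if b: "b \<in> dyadic_verts" for b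
  proof (cases "b < a")
    case True
    then show ?thesis using act_less_iff[OF a' b] a by (auto simp: below_def)
  next
    case False
    then show ?thesis using act_ge[OF a' b] by simp
  qed
  show "act a ` star (full_subgraph dyadic_trickle (below x)) a = star (full_subgraph dyadic_trickle (below x)) a"
    unfolding star
  proof (intro equalityI subsetI)
    fix b assume "b \<in> below x"
    then have b: "b \<in> dyadic_verts" "b \<le> ereal x" by (simp_all add: below_def)
    obtain c where c: "c \<in> dyadic_verts" "act a c = b" using act_surj[OF a' b(1)] .
    then have "c \<in> below x" using le[OF c(1)] b by (simp add: below_def)
    then show "b \<in> act a ` below x" using c by blast
  qed (use le act_vert[OF a'] in \<open>auto simp: below_def\<close>)
qed

section \<open>Words and group presentations\<close>

lemma words_Nil [simp]: "[] \<in> words X"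
  by (simp add: words_def)

lemma words_Cons [simp]: "p # w \<in> words X \<longleftrightarrow> fst p \<in> X \<and> w \<in> words X"
  by (cases p) (auto simp: words_def)

lemma words_append [simp]: "u @ v \<in> words X \<longleftrightarrow> u \<in> words X \<and> v \<in> words X"
  by (auto simp: words_def)

lemma pres_eq_context:
  "pres_eq X R u v \<Longrightarrow> x \<in> words X \<Longrightarrow> y \<in> words X \<Longrightarrow> pres_eq X R (x @ u @ y) (x @ v @ y)"
  by (intro pres_eq.append pres_eq.refl)

lemma pres_eq_Cons: "pres_eq X R u v \<Longrightarrow> fst p \<in> X \<Longrightarrow> pres_eq X R (p # u) (p # v)"
  using pres_eq.append[OF pres_eq.refl[of "[p]" X R]] by simp

declare pres_eq.trans [trans]

definition flip :: "'a \<times> bool \<Rightarrow> 'a \<times> bool" where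
  "flip p = (fst p, \<not> snd p)"

lemma flip_simps [simp]: "fst (flip p) = fst p" "flip (flip p) = p" "flip (x, b) = (x, \<not> b)"
  by (simp_all add: flip_def)

lemma pres_eq_flip: "fst p \<in> X \<Longrightarrow> pres_eq X R [p, flip p] []" "fst p \<in> X \<Longrightarrow> pres_eq X R [flip p, p] []"
  using pres_eq.cancel[of "fst p" X R "snd p"] pres_eq.cancel[of "fst p" X R "\<not> snd p"]
  by (cases p; simp)+

lemma pres_eq_insert:
  assumes "u \<in> words X" "v \<in> words X" "fst p \<in> X"
  shows "pres_eq X R (u @ v) (u @ [p, flip p] @ v)"
  using pres_eq.sym[OF pres_eq_context[OF pres_eq_flip(1)[OF assms(3)] assms(1,2)]] by simp

text \<open>This and the next lemma turn a relation \<open>p q = r p\<close> between letters into the relations for the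
  inverses of \<open>q\<close> and of \<open>p\<close>.\<close>

lemma pres_eq_swap_flip_right:
  assumes e: "pres_eq X R [p, q] [r, p]"
  shows "pres_eq X R [p, flip q] [flip r, p]"
proof -
  have w: "fst p \<in> X" "fst q \<in> X" "fst r \<in> X" using pres_eq_words[OF e] by auto
  have "pres_eq X R [p, flip q] [flip r, r, p, flip q]"
    using pres_eq_insert[of "[]" X "[p, flip q]" "flip r"] w by simp
  also have "pres_eq X R \<dots> [flip r, p, q, flip q]"
    using pres_eq_context[OF pres_eq.sym[OF e], of "[flip r]" "[flip q]"] w by simp
  also have "pres_eq X R \<dots> [flip r, p]"
    using pres_eq.sym[OF pres_eq_insert[of "[flip r, p]" X "[]" q R]] w by simp
  finally show ?thesis .
qed

lemma pres_eq_swap_flip_left: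
  assumes e: "pres_eq X R [p, q] [r, p]"
  shows "pres_eq X R [flip p, r] [q, flip p]"
proof -
  have w: "fst p \<in> X" "fst q \<in> X" "fst r \<in> X" using pres_eq_words[OF e] by auto
  have "pres_eq X R [flip p, r] [flip p, r, p, flip p]"
    using pres_eq_insert[of "[flip p, r]" X "[]" p] w by simp
  also have "pres_eq X R \<dots> [flip p, p, q, flip p]"
    using pres_eq_context[OF pres_eq.sym[OF e], of "[flip p]" "[flip p]"] w by simp
  also have "pres_eq X R \<dots> [q, flip p]"
    using pres_eq.sym[OF pres_eq_insert[of "[]" X "[q, flip p]" "flip p" R]] w by simp
  finally show ?thesis .
qed

definition inverse_word :: "'a word \<Rightarrow> 'a word" where
  "inverse_word w = map flip (rev w)"

lemma inverse_word_words [simp]: "inverse_word w \<in> words X \<longleftrightarrow> w \<in> words X"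
  by (induction w) (auto simp: inverse_word_def)

lemma inverse_word_inverse: "inverse_word (inverse_word w) = w"
  by (simp add: inverse_word_def rev_map o_def)

lemma pres_eq_inverse_word: "w \<in> words X \<Longrightarrow> pres_eq X R (w @ inverse_word w) []"
proof (induction w)
  case Nil
  then show ?case by (simp add: inverse_word_def pres_eq.refl)
next
  case (Cons p w)
  have "pres_eq X R ([p] @ (w @ inverse_word w) @ [flip p]) ([p] @ [] @ [flip p])"
    using Cons by (intro pres_eq_context) auto
  then show ?case using pres_eq.trans[OF _ pres_eq_flip(1)[of p X R]] Cons.prems by (simp add: inverse_word_def)
qed

text \<open>An evaluation of words that is multiplicative, onto, and identifies exactly the words equal in
  the presented group descends to an isomorphism. It serves both for the maps of the line and for
  maps between trickle groups.\<close>

lemma presented_group_iso: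
  assumes carrier: "ev ` words X = carrier G"
    and mult: "\<And>u v. u \<in> words X \<Longrightarrow> v \<in> words X \<Longrightarrow> ev (u @ v) = ev u \<otimes>\<^bsub>G\<^esub> ev v"
    and eq: "\<And>u v. u \<in> words X \<Longrightarrow> v \<in> words X \<Longrightarrow> pres_eq X R u v \<longleftrightarrow> ev u = ev v"
  shows "\<exists>\<Phi>\<in>iso (presented_group X R) G. \<forall>w\<in>words X. \<Phi> (pres_class X R w) = ev w"
proof -
  define \<Phi> where "\<Phi> A = ev (SOME w. w \<in> A)" for A
  have \<Phi>: "\<Phi> (pres_class X R w) = ev w" if "w \<in> words X" for w
  proof -
    have "w \<in> pres_class X R w" using that by (simp add: pres_class_def pres_eq.refl)
    then have "(SOME w'. w' \<in> pres_class X R w) \<in> pres_class X R w" by (rule someI)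
    then have "pres_eq X R w (SOME w'. w' \<in> pres_class X R w)" by (simp add: pres_class_def)
    then show ?thesis using eq pres_eq_words unfolding \<Phi>_def by metis
  qed
  have c: "carrier (presented_group X R) = pres_class X R ` words X" by (simp add: presented_group_def)
  have "\<Phi> \<in> hom (presented_group X R) G"
    using carrier by (auto simp: hom_def c \<Phi> presented_group_mult mult)
  moreover have "inj_on \<Phi> (carrier (presented_group X R))"
    using eq by (auto simp: inj_on_def c \<Phi> pres_class_eq_iff)
  moreover have "\<Phi> ` carrier (presented_group X R) = carrier G"
    using carrier \<Phi> by (force simp: c image_image)
  ultimately show ?thesis using \<Phi> by (auto simp: iso_def bij_betw_def)
qed

section \<open>The trickle group embeds into the homeomorphisms of the line\<close>

abbreviation signed_map :: "ereal \<times> bool \<Rightarrow> real \<Rightarrow> real" where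
  "signed_map p \<equiv> (if snd p then hmap_ext (fst p) else inv_into UNIV (hmap_ext (fst p)))"

primrec word_map :: "ereal word \<Rightarrow> real \<Rightarrow> real" where
  "word_map [] = id"
| "word_map (p # w) = signed_map p \<circ> word_map w"

lemma word_map_append: "word_map (u @ v) = word_map u \<circ> word_map v"
  by (induction u) (simp_all add: o_assoc)

lemma signed_map_pl: "fst p \<in> dyadic_verts \<Longrightarrow> signed_map p \<in> dyadic_pl"
  by (simp add: hmap_ext_pl dyadic_pl_inv)

lemma word_map_pl: "w \<in> words dyadic_verts \<Longrightarrow> word_map w \<in> dyadic_pl"
proof (induction w)
  case Nil
  then show ?case using dyadic_pl_translation[of 0] by (simp add: id_def)
next
  case (Cons p w)
  then show ?case
    unfolding word_map.simps by (intro dyadic_pl_comp signed_map_pl) auto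
qed

abbreviation dyadic_eq :: "ereal word \<Rightarrow> ereal word \<Rightarrow> bool" where
  "dyadic_eq \<equiv> pres_eq dyadic_verts (trickle_rels dyadic_trickle)"

text \<open>For \<open>b < a\<close> the automorphism attached to \<open>b\<close> fixes \<open>a\<close>, so the relation of the edge reduces to the
  conjugation rule.\<close>

lemma word_map_sound:
  "dyadic_eq u v \<Longrightarrow> word_map u = word_map v"
proof (induction rule: pres_eq.induct)
  case (append u u' v v')
  then show ?case by (simp add: word_map_append)
next
  case (cancel a b)
  then show ?case using hmap_ext_bij[OF cancel]
    by (auto simp: fun_eq_iff bij_is_surj surj_f_inv_f bij_is_inj inv_f_f)
next
  case (relation u v)
  then obtain a b where ab: "a \<in> dyadic_verts" "b \<in> dyadic_verts" "a \<noteq> b"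
    and uv: "u = [(act a b, True), (a, True)]" "v = [(act b a, True), (b, True)]"
    by (auto simp: trickle_rels_def)
  consider "a < b" | "b < a" using ab by fastforce
  then show ?case
  proof cases
    case 1
    then show ?thesis using ab act_ge[of a b] hmap_ext_conj[of b a] by (auto simp: uv fun_eq_iff)
  next
    case 2
    then show ?thesis using ab act_ge[of b a] hmap_ext_conj[of a b] by (auto simp: uv fun_eq_iff)
  qed
qed auto

text \<open>A larger letter moves to the right past a smaller one, for all four choices of signs.\<close>

lemma dyadic_swap:
  assumes a: "a \<in> dyadic_verts" and b: "b \<in> dyadic_verts" "b < a"
  shows "\<exists>b'\<in>dyadic_verts. b' < a \<and> dyadic_eq [(a, s), (b, e)] [(b', e), (a, s)]"
proof -
  have rel: "dyadic_eq [(a, True), (c, True)] [(act a c, True), (a, True)]"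
    if c: "c \<in> dyadic_verts" "c < a" for c
  proof (rule pres_eq.sym, rule pres_eq.relation)
    have "act c a = a" using act_ge[of c a] a c by simp
    then show "([(act a c, True), (a, True)], [(a, True), (c, True)]) \<in> trickle_rels dyadic_trickle"
      unfolding trickle_rels_def using a c by fastforce
  qed (use a c act_vert[OF a c(1)] in simp_all)
  have rel': "dyadic_eq [(a, True), (c, e)] [(act a c, e), (a, True)]"
    if c: "c \<in> dyadic_verts" "c < a" for c
    using rel[OF c] pres_eq_swap_flip_right[OF rel[OF c]] by (cases e) simp_all
  show ?thesis
  proof (cases s)
    case True
    then show ?thesis using rel'[OF b] act_vert[OF a b(1)] act_less_iff[OF a b(1)] b(2) by auto
  next
    case False
    obtain c where c: "c \<in> dyadic_verts" "act a c = b" using act_surj[OF a b(1)] .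
    have "c < a" using act_less_iff[OF a c(1)] c b by simp
    then have "dyadic_eq [(a, False), (b, e)] [(c, e), (a, False)]"
      using pres_eq_swap_flip_left[OF rel'[OF c(1)]] c(2) by simp
    then show ?thesis using False c(1) \<open>c < a\<close> by (intro bexI[of _ c] conjI) simp_all
  qed
qed

lemma dyadic_swap_word:
  assumes a: "a \<in> dyadic_verts"
  shows "w \<in> words dyadic_verts \<Longrightarrow> (\<forall>p\<in>set w. fst p < a) \<Longrightarrow>
    \<exists>w'\<in>words dyadic_verts. (\<forall>p\<in>set w'. fst p < a) \<and> length w' = length w \<and>
      dyadic_eq ((a, s) # w) (w' @ [(a, s)])"
proof (induction w)
  case Nil
  then show ?case using a by (intro bexI[of _ "[]"]) (simp_all add: pres_eq.refl)
next
  case (Cons p w)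
  obtain w' where w': "w' \<in> words dyadic_verts" "\<forall>p\<in>set w'. fst p < a" "length w' = length w"
    "dyadic_eq ((a, s) # w) (w' @ [(a, s)])"
    using Cons by auto
  obtain b where b: "b \<in> dyadic_verts" "b < a" "dyadic_eq [(a, s), p] [(b, snd p), (a, s)]"
    using dyadic_swap[OF a, of "fst p" s "snd p"] Cons.prems by auto
  have "dyadic_eq ((a, s) # p # w) ((b, snd p) # (a, s) # w)"
    using pres_eq_context[OF b(3), of "[]" w] Cons.prems by simp
  moreover have "dyadic_eq ((b, snd p) # (a, s) # w) ((b, snd p) # w' @ [(a, s)])"
    using w'(4) b(1) by (intro pres_eq_Cons) auto
  ultimately have "dyadic_eq ((a, s) # p # w) (((b, snd p) # w') @ [(a, s)])"
    by (auto intro: pres_eq.trans)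
  then show ?case using w' b by (intro bexI[of _ "(b, snd p) # w'"]) auto
qed

text \<open>The largest letter collects at the right end. Replacing the remaining letters by their
  images keeps their number and keeps them below \<open>a\<close>, so the prefix is shorter than the word
  if \<open>a\<close> occurs in it.\<close>

lemma dyadic_collect:
  assumes a: "a \<in> dyadic_verts"
  shows "w \<in> words dyadic_verts \<Longrightarrow> (\<forall>p\<in>set w. fst p \<le> a) \<Longrightarrow>
    \<exists>w' k s. w' \<in> words dyadic_verts \<and> (\<forall>p\<in>set w'. fst p < a) \<and>
      length w' = length (filter (\<lambda>p. fst p \<noteq> a) w) \<and> dyadic_eq w (w' @ replicate k (a, s))"
proof (induction w)
  case Nil
  then show ?case by (intro exI[of _ "[]"] exI[of _ 0]) (simp add: pres_eq.refl)
next
  case (Cons p w)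
  obtain w' k s where w': "w' \<in> words dyadic_verts" "\<forall>p\<in>set w'. fst p < a"
    "length w' = length (filter (\<lambda>p. fst p \<noteq> a) w)" "dyadic_eq w (w' @ replicate k (a, s))"
    using Cons by auto
  have p: "fst p \<in> dyadic_verts" "fst p \<le> a" using Cons.prems by auto
  have e: "dyadic_eq (p # w) (p # w' @ replicate k (a, s))" by (rule pres_eq_Cons[OF w'(4) p(1)])
  show ?case
  proof (cases "fst p = a")
    case False
    then show ?thesis using w' e p
      by (intro exI[of _ "p # w'"] exI[of _ k] exI[of _ s]) auto
  next
    case True
    define t where "t = snd p"
    have pt: "p = (a, t)" using True by (simp add: t_def prod_eq_iff)
    obtain v where v: "v \<in> words dyadic_verts" "\<forall>p\<in>set v. fst p < a" "length v = length w'"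
      "dyadic_eq (p # w') (v @ [p])"
      using dyadic_swap_word[OF a w'(1,2), of t] pt by auto
    have rw: "replicate k (a, s) \<in> words dyadic_verts" for k s using a by (induction k) auto
    have "dyadic_eq (p # w) (v @ p # replicate k (a, s))"
      using pres_eq.trans[OF e] pres_eq.append[OF v(4) pres_eq.refl[OF rw]] by simp
    moreover have "\<exists>j r. dyadic_eq (v @ p # replicate k (a, s)) (v @ replicate j (a, r))"
    proof (cases "s = t \<or> k = 0")
      case True
      then have "p # replicate k (a, s) = replicate (Suc k) (a, t)" using pt by auto
      then show ?thesis using pres_eq.refl[of "v @ replicate (Suc k) (a, t)"] v(1) rw words_append by metis
    next
      case False
      then obtain j where j: "k = Suc j" by (cases k) auto
      have "p # replicate k (a, s) = [p, flip p] @ replicate j (a, s)"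
        using False j pt by auto
      then have "dyadic_eq (v @ p # replicate k (a, s)) (v @ replicate j (a, s))"
        using pres_eq.sym[OF pres_eq_insert[OF v(1) rw p(1), of _ j s]] by simp
      then show ?thesis by blast
    qed
    ultimately obtain j r where "dyadic_eq (p # w) (v @ replicate j (a, r))"
      by (blast intro: pres_eq.trans)
    then show ?thesis using v w' True by (intro exI[of _ v] exI[of _ j] exI[of _ r]) auto
  qed
qed

text \<open>A letter acts as the identity to the right of its vertex.\<close>

lemma word_map_ge:
  "w \<in> words dyadic_verts \<Longrightarrow> (\<forall>p\<in>set w. fst p \<le> ereal t) \<Longrightarrow> word_map w t = t"
proof (induction w)
  case (Cons p w)
  then have a: "fst p \<in> dyadic_verts" "fst p \<le> ereal t" "word_map w t = t" by auto
  have "fst p \<noteq> - \<infinity>" using a(1) by (auto simp: dyadic_verts_def)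
  then have h: "hmap_ext (fst p) t = t" using a(2) by (rule hmap_ext_ge[rotated])
  then have "inv_into UNIV (hmap_ext (fst p)) t = t"
    using inv_f_f[OF bij_is_inj[OF hmap_ext_bij[OF a(1)]], of t] by simp
  then show ?case using a h by simp
qed simp

lemma word_map_power_descends:
  assumes a: "a \<in> dyadic_verts" and t: "ereal t < a" and k: "k > 0"
  shows "(hmap_ext a ^^ k) t < t"
  using k
proof (induction k rule: nat_induct_non_zero)
  case 1
  then show ?case using hmap_ext_descends[OF a t] by simp
next
  case (Suc k)
  then have "ereal ((hmap_ext a ^^ k) t) < a" using t by (meson ereal_less_eq(3) less_imp_le order_le_less_trans)
  then show ?case using hmap_ext_descends[OF a] Suc by fastforce
qed

lemma word_map_replicate_moves:
  assumes a: "a \<in> dyadic_verts" and t: "ereal t < a" and k: "k > 0"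
  shows "word_map (replicate k (a, s)) r = t \<Longrightarrow> r \<noteq> t"
proof (cases s)
  case True
  have "word_map (replicate k (a, True)) = hmap_ext a ^^ k" by (induction k) auto
  then show "word_map (replicate k (a, s)) r = t \<Longrightarrow> r \<noteq> t"
    using True word_map_power_descends[OF a t k] by auto
next
  case False
  have "(hmap_ext a ^^ k) (word_map (replicate k (a, False)) r) = r" for k
  proof (induction k arbitrary: r)
    case (Suc k)
    have "(hmap_ext a ^^ Suc k) (word_map (replicate (Suc k) (a, False)) r)
      = (hmap_ext a ^^ k) (hmap_ext a (inv_into UNIV (hmap_ext a) (word_map (replicate k (a, False)) r)))"
      by (simp only: funpow_Suc_right o_apply replicate_Suc word_map.simps snd_conv fst_conv if_False)
    then show ?case using Suc surj_f_inv_f[OF bij_is_surj[OF hmap_ext_bij[OF a]]] by simp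
  qed simp
  then show "word_map (replicate k (a, s)) r = t \<Longrightarrow> r \<noteq> t"
    using False word_map_power_descends[OF a t k] by force
qed

text \<open>The action on the line is faithful. If the largest letter \<open>a\<close> is collected at the right with
  exponent different from 0, then the collected power maps some point to a different point \<open>t\<close> just below
  \<open>a\<close>; as the smaller letters fix \<open>t\<close>, the word is not the identity.\<close>

lemma word_map_kernel:
  "w \<in> words dyadic_verts \<Longrightarrow> word_map w = id \<Longrightarrow> dyadic_eq w []"
proof (induction w rule: length_induct)
  case (1 w)
  show ?case
  proof (cases "w = []")
    case True
    then show ?thesis by (simp add: pres_eq.refl)
  next
    case False
    define a where "a = Max (fst ` set w)"
    have fin: "finite (fst ` set w)" "fst ` set w \<noteq> {}" using False by auto
    have "a \<in> fst ` set w" unfolding a_def by (rule Max_in[OF fin])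
    then obtain p where p: "p \<in> set w" "fst p = a" by auto
    have le: "\<forall>p\<in>set w. fst p \<le> a" using fin by (auto simp: a_def)
    have a: "a \<in> dyadic_verts" using p 1(2) by (auto simp: words_def)
    obtain w' k s where w': "w' \<in> words dyadic_verts" "\<forall>p\<in>set w'. fst p < a"
      "length w' = length (filter (\<lambda>p. fst p \<noteq> a) w)" "dyadic_eq w (w' @ replicate k (a, s))"
      using dyadic_collect[OF a 1(2) le] by blast
    have m: "word_map w' (word_map (replicate k (a, s)) t) = t" for t
      using word_map_sound[OF w'(4)] 1(3) by (simp add: word_map_append fun_eq_iff)
    have "k = 0"
    proof (rule ccontr)
      assume "k \<noteq> 0"
      \<comment> \<open>The element \<open>-\<infinity>\<close> covers the case of an empty prefix.\<close>
      define M where "M = Max (insert (- \<infinity>) (fst ` set w'))"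
      have "- \<infinity> < a" using a by (auto simp: dyadic_verts_def)
      then have "M < a" using w'(2) by (auto simp: M_def)
      then obtain t where t: "M < ereal t" "ereal t < a" using ereal_dense2 by blast
      have ge: "\<forall>p\<in>set w'. fst p \<le> ereal t"
      proof
        fix p assume "p \<in> set w'"
        then have "fst p \<le> M" unfolding M_def by (intro Max_ge) auto
        then show "fst p \<le> ereal t" using t(1) by simp
      qed
      have "replicate k (a, s) \<in> words dyadic_verts" using a by (induction k) auto
      then obtain r where r: "word_map (replicate k (a, s)) r = t"
        using dyadic_pl_surj[OF word_map_pl] by (metis surjD)
      have "r = t" using m[of r] r word_map_ge[OF w'(1) ge] by simp
      then show False using word_map_replicate_moves[OF a t(2) _ r] \<open>k \<noteq> 0\<close> by simp
    qed
    then have ww': "dyadic_eq w w'" using w'(4) by simp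
    have "length w' < length w"
      using p unfolding w'(3) by (intro length_filter_less[of p]) auto
    moreover have "word_map w' = id" using word_map_sound[OF ww'] 1(3) by metis
    ultimately show ?thesis using 1(1) w'(1) pres_eq.trans[OF ww'] by blast
  qed
qed

lemma word_map_eq_iff:
  assumes u: "u \<in> words dyadic_verts" and v: "v \<in> words dyadic_verts"
  shows "dyadic_eq u v \<longleftrightarrow> word_map u = word_map v"
proof
  assume eq: "word_map u = word_map v"
  have "dyadic_eq (inverse_word u @ u) []"
    using pres_eq_inverse_word[of "inverse_word u"] u by (simp add: inverse_word_inverse)
  then have "word_map (inverse_word u @ v) = id"
    using word_map_sound eq by (fastforce simp: word_map_append)
  then have iv: "dyadic_eq (inverse_word u @ v) []" using u v by (intro word_map_kernel) auto
  have "dyadic_eq ((u @ inverse_word u) @ v) v"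
    using pres_eq.append[OF pres_eq_inverse_word[OF u] pres_eq.refl[OF v]] by simp
  moreover have "dyadic_eq (u @ (inverse_word u @ v)) u"
    using pres_eq.append[OF pres_eq.refl[OF u] iv] by simp
  ultimately show "dyadic_eq u v" by (metis append.assoc pres_eq.sym pres_eq.trans)
qed (rule word_map_sound)

section \<open>Every element of Thompson's group is a word map\<close>

definition word_maps :: "(real \<Rightarrow> real) set" where
  "word_maps = word_map ` words dyadic_verts"

lemma word_maps_id: "id \<in> word_maps"
  unfolding word_maps_def by (rule image_eqI[of _ _ "[]"]) simp_all

lemma word_maps_comp:
  assumes "f \<in> word_maps" "g \<in> word_maps" shows "f \<circ> g \<in> word_maps"
proof -
  obtain u v where "u \<in> words dyadic_verts" "f = word_map u" "v \<in> words dyadic_verts" "g = word_map v"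
    using assms by (auto simp: word_maps_def)
  then show ?thesis unfolding word_maps_def by (intro image_eqI[of _ _ "u @ v"]) (simp_all add: word_map_append)
qed

lemma word_maps_inverse:
  assumes "f \<in> word_maps" shows "\<exists>g\<in>word_maps. (\<forall>t. g (f t) = t) \<and> (\<forall>t. f (g t) = t)"
proof -
  obtain u where u: "u \<in> words dyadic_verts" "f = word_map u" using assms by (auto simp: word_maps_def)
  have "word_map (u @ inverse_word u) = id" "word_map (inverse_word u @ u) = id"
    using word_map_sound[OF pres_eq_inverse_word[OF u(1)]]
      word_map_sound[OF pres_eq_inverse_word[of "inverse_word u"]] u(1) by (simp_all add: inverse_word_inverse)
  then have "\<forall>t. word_map (inverse_word u) (f t) = t" "\<forall>t. f (word_map (inverse_word u) t) = t"
    unfolding word_map_append u(2) by (simp_all add: fun_eq_iff)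
  moreover have "word_map (inverse_word u) \<in> word_maps" using u(1) by (simp add: word_maps_def)
  ultimately show ?thesis by blast
qed

lemma word_maps_cancel:
  assumes g: "g \<in> word_maps" and fg: "f \<circ> g \<in> word_maps" shows "f \<in> word_maps"
proof -
  obtain g' where g': "g' \<in> word_maps" "\<forall>t. g (g' t) = t" using word_maps_inverse[OF g] by blast
  have "f = (f \<circ> g) \<circ> g'" using g'(2) by auto
  then show ?thesis using word_maps_comp[OF fg g'(1)] by simp
qed

lemma word_maps_generator: "a \<in> dyadic_verts \<Longrightarrow> hmap_ext a \<in> word_maps"
  unfolding word_maps_def by (rule image_eqI[of _ _ "[(a, True)]"]) simp_all

lemma word_maps_stretch: "n \<in> \<int> \<Longrightarrow> stretch n \<in> word_maps"
  using word_maps_generator[of "ereal n"] by (simp add: Ints_dyadic hmap_Ints)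

lemma word_maps_translation: "(\<lambda>t. t + of_int i) \<in> word_maps"
proof -
  have neg: "(\<lambda>t. t - of_nat k) \<in> word_maps" for k
  proof (induction k)
    case 0
    then show ?case using word_maps_id by (simp add: id_def)
  next
    case (Suc k)
    have "(\<lambda>t. t - of_nat (Suc k)) = hmap_ext \<infinity> \<circ> (\<lambda>t. t - of_nat k)" by auto
    then show ?case using word_maps_comp[OF word_maps_generator[of \<infinity>] Suc] by simp
  qed
  show ?thesis
  proof (cases "i \<ge> 0")
    case True
    have "(\<lambda>t. t + of_int i) \<circ> (\<lambda>t :: real. t - of_nat (nat i)) = id" using True by auto
    then show ?thesis using word_maps_cancel[OF neg[of "nat i"]] word_maps_id by metis
  next
    case False
    then have "(\<lambda>t. t + of_int i) = (\<lambda>t :: real. t - of_nat (nat (- i)))" by auto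
    then show ?thesis using neg by simp
  qed
qed

text \<open>The unit interval from \<open>n\<close> goes affinely onto the standard dyadic interval of length
  \<open>2\<^sup>-\<^sup>m\<close> starting at \<open>a / 2\<^sup>m\<close>, where \<open>m\<close> and \<open>a\<close> depend on \<open>n\<close>, and outside of the window from \<open>l\<close>
  to \<open>h\<close> all these lengths are 1. In terms of forest diagrams, the source forest is trivial.\<close>

definition standard_on_units :: "(real \<Rightarrow> real) \<Rightarrow> int \<Rightarrow> int \<Rightarrow> bool" where
  "standard_on_units f l h \<longleftrightarrow> (\<exists>m :: int \<Rightarrow> nat. \<exists>a :: int \<Rightarrow> int.
     (\<forall>n s. 0 \<le> s \<longrightarrow> s \<le> 1 \<longrightarrow> f (of_int n + s) = (of_int (a n) + s) / 2 ^ m n) \<and>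
     (\<forall>n. n < l \<or> h \<le> n \<longrightarrow> m n = 0))"

text \<open>A shortest image interval and the image adjacent to it on the side of its sibling share
  an end point with odd numerator over \<open>2\<^sup>M\<close>, so the adjacent one is as short and the two are the halves
  of a standard interval. Precomposition with one \<open>stretch\<close> merges the two unit intervals into
  one and shrinks the window.\<close>

lemma standard_on_units_word_map:
  "standard_on_units f l h \<Longrightarrow> f \<in> word_maps"
proof (induction "nat (h - l)" arbitrary: f l rule: less_induct)
  case less
  obtain m a where f: "\<And>n s. 0 \<le> s \<Longrightarrow> s \<le> 1 \<Longrightarrow> f (of_int n + s) = (of_int (a n) + s) / 2 ^ m n"
    and m: "\<And>n. n < l \<or> h \<le> n \<Longrightarrow> m n = 0"
    using less.prems unfolding standard_on_units_def by blast
  have join: "(of_int (a n) + 1) / 2 ^ m n = (of_int (a (n + 1)) / 2 ^ m (n + 1) :: real)" for n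
    using f[of 1 n] f[of 0 "n + 1"] by simp
  have fl: "f t = (of_int (a \<lfloor>t\<rfloor>) + (t - of_int \<lfloor>t\<rfloor>)) / 2 ^ m \<lfloor>t\<rfloor>" for t
  proof -
    have "0 \<le> t - of_int \<lfloor>t\<rfloor>" "t - of_int \<lfloor>t\<rfloor> \<le> 1" by linarith+
    from f[OF this, of "\<lfloor>t\<rfloor>"] show ?thesis by simp
  qed
  show ?case
  proof (cases "\<forall>n. m n = 0")
    case True
    have step: "a (n + 1) = a n + 1" for n
    proof -
      have "real_of_int (a (n + 1)) = of_int (a n + 1)" using join[of n] True by simp
      then show ?thesis by (simp only: of_int_eq_iff)
    qed
    have a: "a n = a 0 + n" for n
    proof (induction n rule: int_induct[where k = 0])
      case (step2 i)
      then show ?case using step[of "i - 1"] by simp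
    qed (simp_all add: step)
    have "f t = t + of_int (a 0)" for t using fl[of t] True a[of "\<lfloor>t\<rfloor>"] by simp
    then have "f = (\<lambda>t. t + of_int (a 0))" by auto
    then show ?thesis using word_maps_translation by simp
  next
    case False
    define S where "S = {n. m n \<noteq> 0}"
    have "S \<subseteq> {l..<h}" using m unfolding S_def by (metis (mono_tags, lifting) atLeastLessThan_iff mem_Collect_eq not_le subsetI)
    then have S: "finite S" "S \<noteq> {}" using False finite_subset by (auto simp: S_def)
    define M where "M = Max (m ` S)"
    have "M \<in> m ` S" unfolding M_def using S by (intro Max_in) auto
    then obtain n where n: "m n = M" "n \<in> S" by auto
    have max: "m i \<le> M" for i
    proof (cases "i \<in> S")
      case True
      then show ?thesis unfolding M_def using S by (intro Max_ge) auto
    qed (simp add: S_def)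
    have Mpos: "M > 0" using n by (auto simp: S_def)
    have ints: "x * 2 ^ m i = y * 2 ^ m j"
      if "(of_int x / 2 ^ m j :: real) = of_int y / 2 ^ m i" for x y i j
    proof -
      have "(of_int (x * 2 ^ m i) :: real) = of_int (y * 2 ^ m j)" using that by (simp add: field_simps)
      then show ?thesis by (simp only: of_int_eq_iff)
    qed
    have pow: "i = M" if x: "odd x" "x * 2 ^ i = y * 2 ^ M" "i \<le> M" for x y :: int and i
    proof (rule ccontr)
      assume "i \<noteq> M"
      then obtain j where "M = i + Suc j" using x(3) by (metis le_neq_implies_less less_imp_Suc_add add_Suc_right)
      then have "x = y * 2 ^ Suc j" using x(2) by (simp add: power_add)
      then show False using x(1) by simp
    qed
    \<comment> \<open>The images of the unit intervals from \<open>p\<close> and from \<open>p + 1\<close> are the left and the right half of one standard interval.\<close>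
    obtain p where p: "m p = M" "m (p + 1) = M" "even (a p)" "a (p + 1) = a p + 1"
    proof (cases "even (a n)")
      case True
      have e: "(a n + 1) * 2 ^ m (n + 1) = a (n + 1) * 2 ^ M"
        using ints[of "a n + 1" n "a (n + 1)" "n + 1"] join[of n] n(1) by simp
      have "odd (a n + 1)" using True by simp
      then have "m (n + 1) = M" by (rule pow[OF _ e max])
      then show ?thesis using that[of n] n(1) True e by simp
    next
      case False
      have e: "(a (n - 1) + 1) * 2 ^ M = a n * 2 ^ m (n - 1)"
        using ints[of "a (n - 1) + 1" "n - 1" "a n" n] join[of "n - 1"] n(1) by simp
      have mn: "m (n - 1) = M" by (rule pow[OF False e[symmetric] max])
      then have an: "a (n - 1) + 1 = a n" using e by simp
      then have "even (a (n - 1))" using False by presburger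
      then show ?thesis using that[of "n - 1"] n(1) mn an by simp
    qed
    have window: "l \<le> p" "p + 1 < h" using m[of p] m[of "p + 1"] p Mpos by (force simp: not_less[symmetric])+
    define g where "g = stretch (of_int (p + 2))"
    have g: "g \<in> word_maps" unfolding g_def by (rule word_maps_stretch) simp
    \<comment> \<open>The merged interval starts at \<open>p + 1\<close>; everything to its left has moved by one unit.\<close>
    define m' where "m' i = (if i \<le> p then m (i - 1) else if i = p + 1 then M - 1 else m i)" for i
    define a' where "a' i = (if i \<le> p then a (i - 1) else if i = p + 1 then a p div 2 else a i)" for i
    have "(f \<circ> g) (of_int i + s) = (of_int (a' i) + s) / 2 ^ m' i" if s: "0 \<le> s" "s \<le> 1" for i s
    proof -
      consider "i \<le> p" | "i = p + 1" | "i \<ge> p + 2" by linarith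
      then show ?thesis
      proof cases
        case 1
        then have "real_of_int i \<le> of_int p" by simp
        then have "g (of_int i + s) = of_int (i - 1) + s"
          using s unfolding g_def by (subst stretch_simps) auto
        then show ?thesis using f[OF s, of "i - 1"] 1 by (simp add: a'_def m'_def)
      next
        case 2
        have gi: "g (of_int i + s) = of_int p + 2 * s"
          using s unfolding g_def 2 by (subst stretch_simps(2)) auto
        have half: "real_of_int (a p div 2) = of_int (a p) / 2" using p(3) by (auto elim: evenE)
        have "f (of_int p + 2 * s) = (of_int (a p) + 2 * s) / 2 ^ M"
        proof (cases "2 * s \<le> 1")
          case True
          then show ?thesis using f[of "2 * s" p] s p by simp
        next
          case False
          have "of_int p + 2 * s = of_int (p + 1) + (2 * s - 1)" by simp
          then show ?thesis using f[of "2 * s - 1" "p + 1"] False s p by simp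
        qed
        also have "\<dots> = (of_int (a p div 2) + s) / 2 ^ (M - 1)"
          using Mpos half by (cases M) (auto simp: field_simps)
        finally show ?thesis using gi 2 by (simp add: a'_def m'_def)
      next
        case 3
        then have "real_of_int (p + 2) \<le> of_int i" by (simp only: of_int_le_iff)
        then have "g (of_int i + s) = of_int i + s"
          using s unfolding g_def by (subst stretch_simps(3)) auto
        then show ?thesis using f[OF s, of i] 3 by (simp add: a'_def m'_def)
      qed
    qed
    moreover have "m' i = 0" if "i < l + 1 \<or> h \<le> i" for i
      using that window m[of "i - 1"] m[of i] by (auto simp: m'_def)
    ultimately have "standard_on_units (f \<circ> g) (l + 1) h" unfolding standard_on_units_def by blast
    then have "f \<circ> g \<in> word_maps" using window by (intro less.hyps) auto
    then show ?thesis by (rule word_maps_cancel[OF g])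
  qed
qed

text \<open>Applying the maps \<open>stretch\<close> at \<open>M, M - 2, M - 4, \<dots>\<close> expands one more unit interval to the left of
  \<open>M\<close> at each step by the factor 2.\<close>

lemma word_maps_expand:
  "\<exists>g\<in>word_maps. \<forall>t. g t = (if of_int M \<le> t then t
      else if of_int M - of_nat K \<le> t then 2 * t - of_int M else t - of_nat K)"
proof (induction K)
  case 0
  show ?case by (rule bexI[OF _ word_maps_id]) auto
next
  case (Suc K)
  then obtain g where g: "g \<in> word_maps" "\<And>t. g t = (if of_int M \<le> t then t
      else if of_int M - of_nat K \<le> t then 2 * t - of_int M else t - of_nat K)" by blast
  have "stretch (of_int (M - 2 * int K)) \<circ> g \<in> word_maps"
    by (intro word_maps_comp word_maps_stretch g) simp
  then show ?case
    by (rule bexI[rotated]) (auto simp: g(2) stretch_def min_def max_def)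
qed

lemma word_maps_expand_power:
  "\<exists>g\<in>word_maps. \<forall>t. g t = (if of_int M \<le> t then t
      else if of_int M - of_nat K \<le> t then of_int M + 2 ^ N * (t - of_int M)
      else t - (2 ^ N - 1) * of_nat K)"
proof (induction N)
  case 0
  show ?case by (rule bexI[OF _ word_maps_id]) auto
next
  case (Suc N)
  then obtain g where g: "g \<in> word_maps" "\<And>t. g t = (if of_int M \<le> t then t
      else if of_int M - of_nat K \<le> t then of_int M + 2 ^ N * (t - of_int M)
      else t - (2 ^ N - 1) * of_nat K)" by blast
  obtain d where d: "d \<in> word_maps" "\<And>t. d t = (if of_int M \<le> t then t
      else if of_int M - of_nat (2 ^ N * K) \<le> t then 2 * t - of_int M else t - of_nat (2 ^ N * K))"
    using word_maps_expand by blast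
  have "(d \<circ> g) t = (if of_int M \<le> t then t
      else if of_int M - of_nat K \<le> t then of_int M + 2 ^ Suc N * (t - of_int M)
      else t - (2 ^ Suc N - 1) * of_nat K)" for t
  proof -
    consider "of_int M \<le> t" | "t < of_int M" "of_int M - of_nat K \<le> t" | "t < of_int M - of_nat K" by linarith
    then show ?thesis
    proof cases
      case 1
      then show ?thesis by (simp add: g d)
    next
      case 2
      have "2 ^ N * (t - of_int M) < 0" using 2 by (simp add: mult_less_0_iff)
      moreover have "2 ^ N * (- of_nat K) \<le> 2 ^ N * (t - of_int M)" using 2 by (intro mult_left_mono) auto
      ultimately show ?thesis using 2 by (simp add: g d)
    next
      case 3
      have "\<not> of_int M \<le> t" using 3 by (smt (verit) of_nat_0_le_iff)
      moreover have "(2 ^ N - 1) * real K \<ge> 0" by simp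
      ultimately show ?thesis using 3 by (simp add: g d algebra_simps)
    qed
  qed
  then show ?case using word_maps_comp[OF d(1) g(1)] by blast
qed

lemma eventually_dyadic_Ints:
  assumes "x \<in> dyadic_rats" shows "\<forall>\<^sub>F N in sequentially. 2 ^ N * x \<in> \<int>"
proof -
  obtain m where m: "2 ^ m * x \<in> \<int>" using assms by (auto simp: dyadic_iff)
  have "2 ^ N * x \<in> \<int>" if "N \<ge> m" for N
  proof -
    have "2 ^ N * x = 2 ^ (N - m) * (2 ^ m * x)" using that by (simp add: power_add[symmetric])
    also have "\<dots> \<in> \<int>" using m by (intro Ints_mult[OF _ m]) auto
    finally show ?thesis .
  qed
  then show ?thesis by (rule eventually_sequentiallyI)
qed

lemma dyadic_pl_grid:
  assumes f: "f \<in> dyadic_pl"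
  shows "\<exists>N0. \<forall>i :: int. dyadic_affine f (of_int i / 2 ^ N0) (of_int (i + 1) / 2 ^ N0)"
proof -
  obtain B where B: "finite B" "B \<subseteq> dyadic_rats"
    "\<And>s t. s < t \<Longrightarrow> B \<inter> {s<..<t} = {} \<Longrightarrow> dyadic_affine f s t"
    using f unfolding dyadic_pl_def by blast
  have "\<forall>\<^sub>F N in sequentially. \<forall>b\<in>B. 2 ^ N * b \<in> \<int>"
    using B(1,2) by (intro eventually_ball_finite ballI eventually_dyadic_Ints) auto
  then obtain N0 where N0: "\<And>b. b \<in> B \<Longrightarrow> 2 ^ N0 * b \<in> \<int>"
    by (auto simp: eventually_sequentially)
  have "dyadic_affine f (of_int i / 2 ^ N0) (of_int (i + 1) / 2 ^ N0)" for i
  proof (rule B(3))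
    show "of_int i / 2 ^ N0 < (of_int (i + 1) / 2 ^ N0 :: real)" by (simp add: divide_strict_right_mono)
    show "B \<inter> {of_int i / 2 ^ N0<..<of_int (i + 1) / 2 ^ N0} = {}"
    proof (rule ccontr)
      assume "B \<inter> {of_int i / 2 ^ N0<..<of_int (i + 1) / 2 ^ N0} \<noteq> {}"
      then obtain b where b: "b \<in> B" "of_int i / 2 ^ N0 < b" "b < of_int (i + 1) / 2 ^ N0" by auto
      obtain j where j: "2 ^ N0 * b = of_int j" using N0[OF b(1)] by (rule Ints_cases)
      have "of_int i < (of_int j :: real)" "of_int j < (of_int (i + 1) :: real)"
        using b(2,3) unfolding j[symmetric] by (simp_all add: field_simps)
      then show False by (simp only: of_int_less_iff)
    qed
  qed
  then show ?thesis by blast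
qed

text \<open>Between the two regions of translation, the inverse of an expansion by \<open>2\<^sup>N\<close> compresses unit
  intervals to length \<open>2\<^sup>-\<^sup>N\<close>. There are only finitely many affine pieces there, so for large \<open>N\<close> each
  compressed interval lies in one piece, and \<open>2\<^sup>N\<close> exceeds the slope and clears the denominator of the
  offset; the image is then a standard dyadic interval of length at most 1.\<close>

lemma dyadic_pl_standard:
  assumes f: "f \<in> dyadic_pl"
  shows "\<exists>g\<in>word_maps. \<exists>l h. standard_on_units (f \<circ> g) l h"
proof -
  obtain L c R d where L: "c \<in> \<int>" "\<And>t. t \<le> L \<Longrightarrow> f t = t + c"
    and R: "d \<in> \<int>" "\<And>t. t \<ge> R \<Longrightarrow> f t = t + d"
    using f unfolding dyadic_pl_def by blast
  obtain ci where ci: "c = of_int ci" using L(1) by (rule Ints_cases)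
  obtain di where di: "d = of_int di" using R(1) by (rule Ints_cases)
  obtain N0 where grid: "\<And>i :: int. dyadic_affine f (of_int i / 2 ^ N0) (of_int (i + 1) / 2 ^ N0)"
    using dyadic_pl_grid[OF f] by blast
  \<comment> \<open>The map is a translation to the right of \<open>M\<close> and to the left of \<open>M - K\<close>.\<close>
  define M where "M = \<lceil>R\<rceil>"
  define K where "K = nat \<lceil>of_int M - L\<rceil>"
  have M: "R \<le> of_int M" by (simp add: M_def)
  have K: "of_int M - of_nat K \<le> L" unfolding K_def by linarith
  \<comment> \<open>On the grid interval \<open>i\<close>, consecutive multiples of \<open>2\<^sup>-\<^sup>N\<close> bound intervals that go to standard ones of length \<open>2\<^sup>-\<^sup>m\<close>.\<close>
  define fits where "fits i N \<longleftrightarrow> (\<exists>m b. \<forall>u. of_int i / 2 ^ N0 \<le> u \<longrightarrow> u \<le> of_int (i + 1) / 2 ^ N0 \<longrightarrow>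
      f u = (2 ^ N * u + of_int b) / 2 ^ m)" for i :: int and N :: nat
  have ev: "\<forall>\<^sub>F N in sequentially. fits i N" for i
  proof -
    obtain k :: int and e where e: "e \<in> dyadic_rats"
      "\<forall>u\<in>{of_int i / 2 ^ N0..of_int (i + 1) / 2 ^ N0}. f u = 2 powi k * u + e"
      using grid[of i] unfolding dyadic_affine_def by blast
    obtain j where j: "\<And>N. N \<ge> j \<Longrightarrow> 2 ^ N * (2 powi (- k) * e) \<in> \<int>"
      using eventually_dyadic_Ints[OF dyadic_mult[OF dyadic_powi e(1)], of "- k"]
      by (auto simp: eventually_sequentially)
    have "fits i N" if N: "N \<ge> max j (nat k)" for N
    proof -
      obtain b where b: "2 ^ N * (2 powi (- k) * e) = of_int b" using j[of N] N by (auto elim: Ints_cases)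
      define m where "m = nat (int N - k)"
      have "int m = int N - k" using N by (auto simp: m_def)
      then have "(2 :: real) ^ m = 2 powi (int N - k)" by (metis power_int_of_nat)
      then have m: "(2 :: real) ^ m = 2 ^ N * 2 powi (- k)" by (simp add: power_int_diff power_int_minus divide_inverse)
      have "2 powi k * u + e = (2 ^ N * u + of_int b) / 2 ^ m" for u
        unfolding m b[symmetric] by (simp add: field_simps power_int_minus)
      then show ?thesis unfolding fits_def using e(2) by (intro exI[of _ m] exI[of _ b]) auto
    qed
    then show ?thesis by (rule eventually_sequentiallyI)
  qed
  define I where "I = {(M - int K) * 2 ^ N0..M * 2 ^ N0}"
  have "\<forall>\<^sub>F N in sequentially. (\<forall>i\<in>I. fits i N) \<and> N \<ge> N0"
    using ev by (intro eventually_conj eventually_ball_finite eventually_ge_at_top) (auto simp: I_def)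
  then obtain N where N: "\<And>i. i \<in> I \<Longrightarrow> fits i N" "N \<ge> N0" by (auto simp: eventually_sequentially)
  obtain g where g: "g \<in> word_maps" "\<And>t. g t = (if of_int M \<le> t then t
      else if of_int M - of_nat K \<le> t then of_int M + 2 ^ N * (t - of_int M)
      else t - (2 ^ N - 1) * of_nat K)"
    using word_maps_expand_power by blast
  obtain g' where g': "g' \<in> word_maps" "\<And>t. g' (g t) = t" using word_maps_inverse[OF g(1)] by blast
  define l where "l = M - 2 ^ N * int K"
  have "\<exists>m a. (\<forall>s. 0 \<le> s \<longrightarrow> s \<le> 1 \<longrightarrow> (f \<circ> g') (of_int n + s) = (of_int a + s) / 2 ^ m) \<and>
      (n < l \<or> M \<le> n \<longrightarrow> m = 0)" for n
  proof -
    consider "M \<le> n" | "n < l" | "l \<le> n" "n < M" by linarith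
    then show ?thesis
    proof cases
      case 1
      then have n: "real_of_int M \<le> of_int n" by simp
      have "(f \<circ> g') (of_int n + s) = of_int (n + di) + s" if s: "0 \<le> s" "s \<le> 1" for s
        using g'(2)[of "of_int n + s"] g(2)[of "of_int n + s"] R(2)[of "of_int n + s"] s n M di by simp
      then show ?thesis by (intro exI[of _ 0] exI[of _ "n + di"]) simp
    next
      case 2
      then have "n + 1 \<le> l" by simp
      then have "real_of_int (n + 1) \<le> of_int l" by (simp only: of_int_le_iff)
      then have n: "real_of_int n + 1 \<le> of_int M - 2 ^ N * of_nat K" by (simp add: l_def)
      \<comment> \<open>Left of the expanded region \<open>g\<close> is the translation by \<open>-z\<close>.\<close>
      define z where "z = (2 ^ N - 1) * int K"
      have z: "real_of_int z = 2 ^ N * of_nat K - of_nat K" by (simp add: z_def algebra_simps)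
      have "(f \<circ> g') (of_int n + s) = of_int (n + z + ci) + s" if s: "0 \<le> s" "s \<le> 1" for s
      proof -
        define t where "t = of_int n + s + of_int z"
        have t: "t \<le> of_int M - of_nat K" using s n z by (simp add: t_def)
        have "g t = of_int n + s"
        proof (cases "t = of_int M - of_nat K")
          case True
          then have "of_int n + s = of_int M - 2 ^ N * of_nat K" using z by (simp add: t_def)
          then show ?thesis using True by (auto simp: g(2))
        next
          case False
          then have "t < of_int M - of_nat K" using t by simp
          moreover from this have "\<not> of_int M \<le> t" by (smt (verit) of_nat_0_le_iff)
          ultimately show ?thesis using z by (simp add: g(2) t_def algebra_simps)
        qed
        then have "g' (of_int n + s) = t" using g'(2)[of t] by simp
        then show ?thesis using L(2)[of t] t K ci by (simp add: t_def)
      qed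
      then show ?thesis by (intro exI[of _ 0] exI[of _ "n + z + ci"]) simp
    next
      case 3
      \<comment> \<open>The expansion \<open>g\<close> maps \<open>j / 2\<^sup>N\<close> to \<open>n\<close>, and \<open>i\<close> is the grid interval containing \<open>j / 2\<^sup>N\<close>.\<close>
      define j where "j = 2 ^ N * M + n - M"
      define i where "i = j div 2 ^ (N - N0)"
      have pw: "(2 :: int) ^ N = 2 ^ N0 * 2 ^ (N - N0)" using N(2) by (simp add: power_add[symmetric])
      have ij: "i * 2 ^ (N - N0) \<le> j" "j + 1 \<le> (i + 1) * 2 ^ (N - N0)"
      proof -
        have "j = i * 2 ^ (N - N0) + j mod 2 ^ (N - N0)" by (simp only: i_def div_mult_mod_eq)
        moreover have "0 \<le> j mod 2 ^ (N - N0)" "j mod 2 ^ (N - N0) < 2 ^ (N - N0)" by simp_all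
        moreover have "(i + 1) * 2 ^ (N - N0) = i * 2 ^ (N - N0) + 2 ^ (N - N0)"
          by (simp add: algebra_simps)
        ultimately show "i * 2 ^ (N - N0) \<le> j" "j + 1 \<le> (i + 1) * 2 ^ (N - N0)" by linarith+
      qed
      have jb: "(M - int K) * 2 ^ N0 * 2 ^ (N - N0) \<le> j" "j < M * 2 ^ N0 * 2 ^ (N - N0)"
        using 3 pw by (simp_all add: j_def l_def algebra_simps)
      have "(M - int K) * 2 ^ N0 \<le> i"
        unfolding i_def using zdiv_mono1[OF jb(1), of "2 ^ (N - N0)"] by (simp del: mult_minus_left)
      moreover have "i \<le> M * 2 ^ N0"
        unfolding i_def using zdiv_mono1[OF less_imp_le[OF jb(2)], of "2 ^ (N - N0)"] by simp
      ultimately have "i \<in> I" by (simp add: I_def)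
      then obtain m b where mb: "\<And>u. of_int i / 2 ^ N0 \<le> u \<Longrightarrow> u \<le> of_int (i + 1) / 2 ^ N0 \<Longrightarrow>
          f u = (2 ^ N * u + of_int b) / 2 ^ m"
        using N(1) unfolding fits_def by blast
      have rij: "real_of_int i * 2 ^ (N - N0) \<le> of_int j" "real_of_int j + 1 \<le> of_int (i + 1) * 2 ^ (N - N0)"
        using ij of_int_le_iff[of "i * 2 ^ (N - N0)" j, where 'a = real]
          of_int_le_iff[of "j + 1" "(i + 1) * 2 ^ (N - N0)", where 'a = real] by simp_all
      have rpw: "(2 :: real) ^ N = 2 ^ N0 * 2 ^ (N - N0)" using N(2) by (simp add: power_add[symmetric])
      have "(f \<circ> g') (of_int n + s) = (of_int (j + b) + s) / 2 ^ m" if s: "0 \<le> s" "s \<le> 1" for s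
      proof -
        define t where "t = (of_int j + s) / 2 ^ N"
        have t2: "2 ^ N * t = of_int j + s" by (simp add: t_def)
        have tM: "t - of_int M = (of_int (n - M) + s) / 2 ^ N"
          by (simp add: t_def j_def field_simps)
        have "real_of_int (n + 1) \<le> of_int M" using 3 by (simp only: of_int_le_iff)
        then have "of_int (n - M) + s \<le> 0" using s by simp
        then have "(of_int (n - M) + s) / 2 ^ N \<le> 0" by (intro divide_nonpos_pos) simp_all
        then have t1: "t \<le> of_int M" using tM by linarith
        have "real_of_int l \<le> of_int n" using 3 by simp
        then have "- (2 ^ N * of_nat K) \<le> of_int (n - M) + s" using s by (simp add: l_def)
        then have "- of_nat K \<le> (of_int (n - M) + s) / 2 ^ N" by (simp add: pos_le_divide_eq mult.commute)
        then have t3: "of_int M - of_nat K \<le> t" using tM by linarith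
        have "g t = of_int M + 2 ^ N * (t - of_int M)" using t1 t3 by (auto simp: g(2))
        then have "g t = of_int n + s" using tM by simp
        then have gt: "g' (of_int n + s) = t" using g'(2)[of t] by simp
        have q: "(2 ^ N0 * t) * 2 ^ (N - N0) = of_int j + s" using t2 unfolding rpw by (simp add: mult_ac)
        have "of_int i * 2 ^ (N - N0) \<le> (2 ^ N0 * t) * 2 ^ (N - N0)"
          "(2 ^ N0 * t) * 2 ^ (N - N0) \<le> of_int (i + 1) * 2 ^ (N - N0)"
          unfolding q using rij s by linarith+
        then have "of_int i \<le> 2 ^ N0 * t" "2 ^ N0 * t \<le> of_int (i + 1)"
          by (meson mult_right_le_imp_le zero_less_numeral zero_less_power)+
        then have "of_int i / 2 ^ N0 \<le> t" "t \<le> of_int (i + 1) / 2 ^ N0"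
          by (simp_all add: field_simps)
        then show ?thesis using mb gt t2 by simp
      qed
      then show ?thesis using 3 by (intro exI[of _ m] exI[of _ "j + b"]) simp
    qed
  qed
  then have "standard_on_units (f \<circ> g') l M" unfolding standard_on_units_def by metis
  then show ?thesis using g'(1) by blast
qed

lemma word_maps_eq: "word_maps = dyadic_pl"
proof
  show "word_maps \<subseteq> dyadic_pl" using word_map_pl by (auto simp: word_maps_def)
  show "dyadic_pl \<subseteq> word_maps"
    using dyadic_pl_standard standard_on_units_word_map word_maps_cancel by blast
qed

lemma Tr_iso_thompson: "Tr dyadic_trickle \<cong> thompson_F"
proof -
  have "\<exists>\<Phi>\<in>iso (Tr dyadic_trickle) thompson_F. \<forall>w\<in>words dyadic_verts.
      \<Phi> (pres_class dyadic_verts (trickle_rels dyadic_trickle) w) = word_map w"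
    unfolding Tr_def dyadic_trickle_simps
    by (rule presented_group_iso)
      (simp_all add: thompson_F_def thompson_maps_eq word_maps_eq[unfolded word_maps_def] word_map_append word_map_eq_iff)
  then show ?thesis by (auto simp: is_iso_def)
qed

section \<open>Unrolling a lower set onto the whole graph\<close>

lemma hmap_iterate_less: "x \<in> dyadic_rats \<Longrightarrow> (hmap x ^^ k) t < x \<longleftrightarrow> t < x"
  by (induction k) (simp_all add: hmap_less_fixpoint)

lemma hmap_iterate_dyadic: "x \<in> dyadic_rats \<Longrightarrow> (hmap x ^^ k) t \<in> dyadic_rats \<longleftrightarrow> t \<in> dyadic_rats"
  by (induction k) (simp_all add: hmap_dyadic_iff)

lemma hmap_iterate_inj: "x \<in> dyadic_rats \<Longrightarrow> (hmap x ^^ k) s = (hmap x ^^ k) t \<longleftrightarrow> s = t"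
  by (induction k) (simp_all add: hmap_inj)

lemma hmap_iterate_conj:
  assumes x: "x \<in> dyadic_rats" and a: "a \<in> dyadic_rats" "a < x"
  shows "(hmap x ^^ k) (hmap a t) = hmap ((hmap x ^^ k) a) ((hmap x ^^ k) t)"
  using assms
  by (induction k) (simp_all add: hmap_conj hmap_iterate_dyadic hmap_iterate_less)

text \<open>The limit of the conjugating maps \<open>h\<^sub>\<infinity>\<^sup>-\<^sup>k h\<^sub>x\<^sup>k\<close>. Below \<open>x\<close> the sequence is eventually constant.\<close>

definition unroll :: "real \<Rightarrow> real \<Rightarrow> real" where
  "unroll x t = lim (\<lambda>k. (hmap x ^^ k) t + of_nat k)"

text \<open>Once an iterate lies in the region where \<open>hmap x\<close> is the translation by \<open>-1\<close>, all later terms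
  agree.\<close>

lemma unroll_settled:
  assumes L: "\<And>t. t \<le> L \<Longrightarrow> hmap x t = t - 1" and k: "(hmap x ^^ k) t \<le> L"
  shows "unroll x t = (hmap x ^^ k) t + of_nat k"
    and "\<forall>\<^sub>F j in sequentially. (hmap x ^^ j) t + of_nat j = unroll x t"
proof -
  have "(hmap x ^^ j) t + of_nat j = (hmap x ^^ k) t + of_nat k \<and> (hmap x ^^ j) t \<le> L" if "k \<le> j" for j
    using that
  proof (induction j rule: dec_induct)
    case (step j)
    then show ?case using L[of "(hmap x ^^ j) t"] by simp
  qed (simp add: k)
  then have ev: "\<forall>\<^sub>F j in sequentially. (hmap x ^^ j) t + of_nat j = (hmap x ^^ k) t + of_nat k"
    by (intro eventually_sequentiallyI) blast
  then show eq: "unroll x t = (hmap x ^^ k) t + of_nat k"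
    unfolding unroll_def by (intro limI tendsto_eventually)
  show "\<forall>\<^sub>F j in sequentially. (hmap x ^^ j) t + of_nat j = unroll x t" using ev unfolding eq .
qed

lemma unroll_eventually:
  assumes x: "x \<in> dyadic_rats" and t: "t < x"
  shows "\<forall>\<^sub>F k in sequentially. (hmap x ^^ k) t + of_nat k = unroll x t"
proof -
  obtain L where L: "\<And>t. t \<le> L \<Longrightarrow> hmap x t = t - 1" using hmap_unit_translation[OF x] by blast
  obtain k where "(hmap x ^^ k) t \<le> L" using hmap_iterates_unbounded[OF x t] by blast
  then show ?thesis using unroll_settled(2)[OF L] by blast
qed

lemma unroll_dyadic:
  assumes x: "x \<in> dyadic_rats" and t: "t < x" "t \<in> dyadic_rats"
  shows "unroll x t \<in> dyadic_rats"
proof -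
  obtain k where "(hmap x ^^ k) t + of_nat k = unroll x t"
    using eventually_happens'[OF _ unroll_eventually[OF x t(1)]] by auto
  then show ?thesis using hmap_iterate_dyadic[OF x, of k t] t(2) by (metis Ints_dyadic Ints_of_nat dyadic_add)
qed

lemma unroll_inj:
  assumes x: "x \<in> dyadic_rats" and s: "s < x" and t: "t < x" and eq: "unroll x s = unroll x t"
  shows "s = t"
proof -
  obtain k where "(hmap x ^^ k) s + of_nat k = unroll x s" "(hmap x ^^ k) t + of_nat k = unroll x t"
    using eventually_happens'[OF _ eventually_conj[OF unroll_eventually[OF x s] unroll_eventually[OF x t]]]
    by auto
  then show ?thesis using eq hmap_iterate_inj[OF x] by (metis add_right_cancel)
qed

text \<open>A preimage of \<open>w\<close> is found by translating \<open>w\<close> far to the left and pulling back along the same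
  number of iterates.\<close>

lemma unroll_surj:
  assumes x: "x \<in> dyadic_rats" and w: "w \<in> dyadic_rats"
  obtains t where "t < x" "t \<in> dyadic_rats" "unroll x t = w"
proof -
  obtain L where L: "\<And>t. t \<le> L \<Longrightarrow> hmap x t = t - 1" using hmap_unit_translation[OF x] by blast
  obtain k :: nat where k: "w - min L (x - 1) \<le> of_nat k" using real_arch_simple by blast
  have "surj (hmap x ^^ k)"
    using dyadic_pl_bij[OF dyadic_pl_hmap[OF x]] by (intro bij_is_surj bij_fn)
  then obtain t where t: "(hmap x ^^ k) t = w - of_nat k" by (metis surjD)
  have "w - of_nat k < x" "w - of_nat k \<le> L" using k by linarith+
  then have "t < x" "unroll x t = w"
    using t hmap_iterate_less[OF x, of k t] unroll_settled(1)[OF L, where k = k and t = t] by auto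
  moreover have "w - of_nat k \<in> dyadic_rats" by (intro dyadic_diff[OF w Ints_dyadic]) auto
  then have "t \<in> dyadic_rats" using t hmap_iterate_dyadic[OF x, of k t] by simp
  ultimately show thesis using that by blast
qed

text \<open>Each iterate of \<open>hmap x\<close> and each integral translation satisfies this relation, and one sufficiently high
  iterate computes all three values of \<open>unroll x\<close>.\<close>

lemma unroll_conj:
  assumes x: "x \<in> dyadic_rats" and a: "a \<in> dyadic_rats" "a < x" and t: "t < x"
  shows "unroll x (hmap a t) = hmap (unroll x a) (unroll x t)"
proof -
  have "hmap a t < x"
    using hmap_descends[OF a(1), of t] hmap_ge[of a t] t by (cases "t < a") auto
  from eventually_conj[OF unroll_eventually[OF x this]
      eventually_conj[OF unroll_eventually[OF x a(2)] unroll_eventually[OF x t]]]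
  obtain k where k: "(hmap x ^^ k) (hmap a t) + of_nat k = unroll x (hmap a t)"
    "(hmap x ^^ k) a + of_nat k = unroll x a" "(hmap x ^^ k) t + of_nat k = unroll x t"
    using eventually_happens'[of sequentially] by auto
  show ?thesis
    unfolding k[symmetric] hmap_iterate_conj[OF x a]
    using x a(1) by (intro hmap_translate[symmetric]) (simp_all add: hmap_iterate_dyadic)
qed

text \<open>The counterpart of the previous lemma for \<open>a = x\<close>, which corresponds to the vertex
  \<open>\<infinity>\<close>.\<close>

lemma unroll_apex:
  assumes x: "x \<in> dyadic_rats" and t: "t < x"
  shows "unroll x (hmap x t) = unroll x t - 1"
proof -
  have "hmap x t < x" using x t by (simp add: hmap_less_fixpoint)
  from eventually_conj[OF unroll_eventually[OF x this]
      eventually_sequentially_Suc[THEN iffD2, OF unroll_eventually[OF x t]]]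
  obtain k where "(hmap x ^^ k) (hmap x t) + of_nat k = unroll x (hmap x t)"
    "(hmap x ^^ Suc k) t + of_nat (Suc k) = unroll x t"
    using eventually_happens'[of sequentially] by auto
  then show ?thesis by (simp add: funpow_swap1)
qed

definition unroll_vert :: "real \<Rightarrow> ereal \<Rightarrow> ereal" where
  "unroll_vert x a = (if a = ereal x then \<infinity> else ereal (unroll x (real_of_ereal a)))"

lemma below_eq: "below x = {ereal y | y. y \<in> dyadic_rats \<and> y \<le> x}"
  by (auto simp: below_def dyadic_verts_def)

lemma unroll_vert_bij:
  assumes x: "x \<in> dyadic_rats"
  shows "bij_betw (unroll_vert x) (below x) dyadic_verts"
proof (rule bij_betw_imageI)
  show "inj_on (unroll_vert x) (below x)"
    by (rule inj_onI) (auto simp: below_eq unroll_vert_def less_le split: if_splits dest: unroll_inj[OF x, rotated 2])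
  show "unroll_vert x ` below x = dyadic_verts"
  proof (intro equalityI subsetI)
    fix b assume "b \<in> unroll_vert x ` below x"
    then obtain y where y: "y \<in> dyadic_rats" "y \<le> x" "b = unroll_vert x (ereal y)" by (auto simp: below_eq)
    then show "b \<in> dyadic_verts"
      using unroll_dyadic[OF x, of y] by (cases "y = x") (simp_all add: unroll_vert_def)
  next
    fix b assume "b \<in> dyadic_verts"
    then show "b \<in> unroll_vert x ` below x"
    proof (cases rule: dyadic_vert_cases)
      case (fin y)
      obtain t where "t < x" "t \<in> dyadic_rats" "unroll x t = y" using unroll_surj[OF x fin(1)] .
      then show ?thesis
        using fin by (intro image_eqI[of _ _ "ereal t"]) (auto simp: below_eq unroll_vert_def)
    next
      case inf
      then show ?thesis using x by (intro image_eqI[of _ _ "ereal x"]) (auto simp: below_eq unroll_vert_def)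
    qed
  qed
qed

lemma unroll_vert_act:
  assumes x: "x \<in> dyadic_rats" and a: "a \<in> below x" and b: "b \<in> below x"
  shows "unroll_vert x (act a b) = act (unroll_vert x a) (unroll_vert x b)"
proof -
  obtain s t where s: "a = ereal s" "s \<in> dyadic_rats" "s \<le> x" and t: "b = ereal t" "t \<in> dyadic_rats" "t \<le> x"
    using a b by (auto simp: below_eq)
  consider "t = x" | "t < x" "s = x" | "t < x" "s < x" using s t by linarith
  then show ?thesis
  proof cases
    case 1
    then show ?thesis using s t by (simp add: unroll_vert_def hmap_ge)
  next
    case 2
    then have "hmap x t \<noteq> x" using hmap_less_fixpoint[OF x, of t] by simp
    then show ?thesis using 2 s t unroll_apex[OF x] by (simp add: unroll_vert_def)
  next
    case 3
    then have "hmap s t < x"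
      using hmap_descends[OF s(2), of t] hmap_ge[of s t] by (cases "t < s") auto
    then show ?thesis using 3 s t unroll_conj[OF x s(2)] by (simp add: unroll_vert_def)
  qed
qed

definition map_word :: "('a \<Rightarrow> 'b) \<Rightarrow> 'a word \<Rightarrow> 'b word" where
  "map_word \<beta> = map (\<lambda>p. (\<beta> (fst p), snd p))"

lemma map_word_simps [simp]:
  "map_word \<beta> [] = []" "map_word \<beta> (p # w) = (\<beta> (fst p), snd p) # map_word \<beta> w"
  "map_word \<beta> (u @ v) = map_word \<beta> u @ map_word \<beta> v"
  "map_word \<beta> (replicate m (x, b)) = replicate m (\<beta> x, b)"
  by (simp_all add: map_word_def)

lemma map_word_words: "\<beta> ` X \<subseteq> Y \<Longrightarrow> w \<in> words X \<Longrightarrow> map_word \<beta> w \<in> words Y"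
  by (induction w) auto

lemma map_word_inverse:
  "(\<And>x. x \<in> X \<Longrightarrow> \<gamma> (\<beta> x) = x) \<Longrightarrow> w \<in> words X \<Longrightarrow> map_word \<gamma> (map_word \<beta> w) = w"
  by (induction w) auto

lemma pres_eq_map_word:
  assumes \<beta>: "\<beta> ` X \<subseteq> Y"
    and R: "\<And>u v. (u, v) \<in> R \<Longrightarrow> u \<in> words X \<Longrightarrow> v \<in> words X \<Longrightarrow> (map_word \<beta> u, map_word \<beta> v) \<in> S"
  shows "pres_eq X R u v \<Longrightarrow> pres_eq Y S (map_word \<beta> u) (map_word \<beta> v)"
proof (induction rule: pres_eq.induct)
  case (relation u v)
  then show ?case using R map_word_words[OF \<beta>] by (blast intro: pres_eq.relation)
qed (use \<beta> map_word_words[OF \<beta>] in \<open>auto intro: pres_eq.intros\<close>)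

lemma trickle_rels_power: "a \<in> verts T \<Longrightarrow> label T a = enat m \<Longrightarrow> (replicate m (a, True), []) \<in> trickle_rels T"
  unfolding trickle_rels_def by blast

lemma trickle_rels_edge:
  "{a, b} \<in> edges T \<Longrightarrow> ([(aut T a b, True), (a, True)], [(aut T b a, True), (b, True)]) \<in> trickle_rels T"
  unfolding trickle_rels_def by blast

lemma trickle_relsE:
  assumes "(u, v) \<in> trickle_rels T"
  obtains (power) a m where "u = replicate m (a, True)" "v = []" "a \<in> verts T" "label T a = enat m"
  | (edge) a b where "u = [(aut T a b, True), (a, True)]" "v = [(aut T b a, True), (b, True)]" "{a, b} \<in> edges T"
  using assms unfolding trickle_rels_def by blast

lemma trickle_eq_map_word:
  assumes vert: "\<And>a. a \<in> verts S \<Longrightarrow> \<beta> a \<in> verts T"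
    and label: "\<And>a. a \<in> verts S \<Longrightarrow> label T (\<beta> a) = label S a"
    and edge: "\<And>a b. a \<in> verts S \<Longrightarrow> b \<in> verts S \<Longrightarrow> {a, b} \<in> edges S \<Longrightarrow> {\<beta> a, \<beta> b} \<in> edges T"
    and aut: "\<And>a b. a \<in> verts S \<Longrightarrow> b \<in> verts S \<Longrightarrow> {a, b} \<in> edges S \<Longrightarrow>
      \<beta> (aut S a b) = aut T (\<beta> a) (\<beta> b)"
    and eq: "pres_eq (verts S) (trickle_rels S) u v"
  shows "pres_eq (verts T) (trickle_rels T) (map_word \<beta> u) (map_word \<beta> v)"
  using _ _ eq
proof (rule pres_eq_map_word)
  show "\<beta> ` verts S \<subseteq> verts T" using vert by auto
  fix u v assume rel: "(u, v) \<in> trickle_rels S" and w: "u \<in> words (verts S)" "v \<in> words (verts S)"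
  show "(map_word \<beta> u, map_word \<beta> v) \<in> trickle_rels T"
    using rel
  proof (cases rule: trickle_relsE)
    case (power a m)
    then show ?thesis using trickle_rels_power[of "\<beta> a" T m] vert label by simp
  next
    case (edge a b)
    then have ab: "a \<in> verts S" "b \<in> verts S" "{b, a} \<in> edges S" using w by (auto simp: insert_commute)
    then show ?thesis using trickle_rels_edge[OF assms(3)[OF ab(1,2) edge(3)]] aut edge by simp
  qed
qed

text \<open>A bijection of vertices that preserves edges, labels and automorphisms carries the defining
  relations onto the defining relations. Closure of the vertices of \<open>S\<close> under the automorphisms makes
  the inverse bijection preserve automorphisms as well.\<close>

lemma induces_isoI:
  fixes S :: "'a trickle" and T :: "'b trickle"
  assumes bij: "bij_betw \<beta> (verts S) (verts T)"
    and edges: "\<And>a b. a \<in> verts S \<Longrightarrow> b \<in> verts S \<Longrightarrow> {\<beta> a, \<beta> b} \<in> edges T \<longleftrightarrow> {a, b} \<in> edges S"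
    and label: "\<And>a. a \<in> verts S \<Longrightarrow> label T (\<beta> a) = label S a"
    and closed: "\<And>a b. a \<in> verts S \<Longrightarrow> b \<in> verts S \<Longrightarrow> {a, b} \<in> edges S \<Longrightarrow> aut S a b \<in> verts S"
    and aut: "\<And>a b. a \<in> verts S \<Longrightarrow> b \<in> verts S \<Longrightarrow> {a, b} \<in> edges S \<Longrightarrow>
      \<beta> (aut S a b) = aut T (\<beta> a) (\<beta> b)"
  shows "induces_iso S T \<beta>"
proof -
  define \<gamma> where "\<gamma> = inv_into (verts S) \<beta>"
  have bv: "\<beta> a \<in> verts T" if "a \<in> verts S" for a
    using bij_betwE[OF bij] that by blast
  have gb: "\<gamma> (\<beta> a) = a" if "a \<in> verts S" for a
    using bij_betw_inv_into_left[OF bij that] by (simp add: \<gamma>_def)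
  have bg: "\<beta> (\<gamma> p) = p" if "p \<in> verts T" for p
    using bij_betw_inv_into_right[OF bij that] by (simp add: \<gamma>_def)
  have gv: "\<gamma> p \<in> verts S" if "p \<in> verts T" for p
    using bij_betwE[OF bij_betw_inv_into[OF bij]] that by (simp add: \<gamma>_def)
  have edges': "{\<gamma> p, \<gamma> q} \<in> edges S" if "p \<in> verts T" "q \<in> verts T" "{p, q} \<in> edges T" for p q
    using edges[OF gv gv, of p q] bg that by simp
  have aut': "\<gamma> (aut T p q) = aut S (\<gamma> p) (\<gamma> q)"
    if "p \<in> verts T" "q \<in> verts T" "{p, q} \<in> edges T" for p q
    using aut[OF gv gv edges', of p q] gb[OF closed[OF gv gv edges', of p q]] bg that by simp
  have label': "label S (\<gamma> p) = label T p" if "p \<in> verts T" for p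
    using label[OF gv[OF that]] bg[OF that] by simp
  define ev where "ev w = pres_class (verts T) (trickle_rels T) (map_word \<beta> w)" for w
  have words: "map_word \<beta> w \<in> words (verts T)" if "w \<in> words (verts S)" for w
    by (rule map_word_words[OF _ that]) (use bv in auto)
  have "\<exists>\<Phi>\<in>iso (presented_group (verts S) (trickle_rels S)) (Tr T). \<forall>w\<in>words (verts S).
      \<Phi> (pres_class (verts S) (trickle_rels S) w) = ev w"
  proof (rule presented_group_iso)
    have "map_word \<beta> ` words (verts S) = words (verts T)"
    proof (intro equalityI subsetI)
      fix w assume w: "w \<in> words (verts T)"
      have "w = map_word \<beta> (map_word \<gamma> w)" using map_word_inverse[of "verts T" \<beta> \<gamma> w] bg w by simp
      moreover have "map_word \<gamma> w \<in> words (verts S)" by (rule map_word_words[OF _ w]) (use gv in auto)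
      ultimately show "w \<in> map_word \<beta> ` words (verts S)" by (rule image_eqI)
    qed (use words in auto)
    moreover have "ev ` words (verts S) = pres_class (verts T) (trickle_rels T) ` map_word \<beta> ` words (verts S)"
      unfolding ev_def image_image ..
    ultimately show "ev ` words (verts S) = carrier (Tr T)"
      by (simp add: Tr_def presented_group_def)
    show "ev (u @ v) = ev u \<otimes>\<^bsub>Tr T\<^esub> ev v" if "u \<in> words (verts S)" "v \<in> words (verts S)" for u v
      using words that by (simp add: ev_def Tr_def presented_group_mult)
    show "pres_eq (verts S) (trickle_rels S) u v \<longleftrightarrow> ev u = ev v"
      if uv: "u \<in> words (verts S)" "v \<in> words (verts S)" for u v
      unfolding ev_def pres_class_eq_iff[OF words[OF uv(1)]]
    proof
      assume "pres_eq (verts S) (trickle_rels S) u v"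
      then show "pres_eq (verts T) (trickle_rels T) (map_word \<beta> u) (map_word \<beta> v)"
        by (rule trickle_eq_map_word[rotated 4]) (use bv label edges aut in simp_all)
    next
      assume "pres_eq (verts T) (trickle_rels T) (map_word \<beta> u) (map_word \<beta> v)"
      then have "pres_eq (verts S) (trickle_rels S) (map_word \<gamma> (map_word \<beta> u)) (map_word \<gamma> (map_word \<beta> v))"
        by (rule trickle_eq_map_word[rotated 4]) (use gv label' edges' aut' in simp_all)
      then show "pres_eq (verts S) (trickle_rels S) u v"
        using map_word_inverse[of "verts S" \<gamma> \<beta>] gb uv by simp
    qed
  qed
  then obtain \<Phi> where "\<Phi> \<in> iso (Tr S) (Tr T)"
    "\<And>w. w \<in> words (verts S) \<Longrightarrow> \<Phi> (pres_class (verts S) (trickle_rels S) w) = ev w"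
    unfolding Tr_def[of S] by blast
  then show ?thesis
    unfolding induces_iso_def Tr_gen_def by (intro bexI[of _ \<Phi>]) (simp_all add: ev_def)
qed

theorem proposition3p16:
  fixes x :: real
  assumes "x \<in> dyadic_rats"
  shows "trickle_graph dyadic_trickle
    \<and> parabolic dyadic_trickle (below x)
    \<and> (\<exists>\<beta>. bij_betw \<beta> (below x) (verts dyadic_trickle) \<and>
            induces_iso (full_subgraph dyadic_trickle (below x)) dyadic_trickle \<beta>)
    \<and> Tr (full_subgraph dyadic_trickle (below x)) \<cong> thompson_F"
proof -
  have bij: "bij_betw (unroll_vert x) (below x) (verts dyadic_trickle)"
    using unroll_vert_bij[OF assms] by simp
  have par: "parabolic dyadic_trickle (below x)" by (rule parabolic_below)
  have below: "below x \<subseteq> dyadic_verts" by (auto simp: below_def)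
  have iso: "induces_iso (full_subgraph dyadic_trickle (below x)) dyadic_trickle (unroll_vert x)"
  proof (rule induces_isoI)
    show "bij_betw (unroll_vert x) (verts (full_subgraph dyadic_trickle (below x))) (verts dyadic_trickle)"
      using bij by (simp add: full_subgraph_def)
    fix a assume "a \<in> verts (full_subgraph dyadic_trickle (below x))"
    then have a: "a \<in> below x" by (simp add: full_subgraph_def)
    show "label dyadic_trickle (unroll_vert x a) = label (full_subgraph dyadic_trickle (below x)) a"
      by (simp add: full_subgraph_def)
    fix b assume "b \<in> verts (full_subgraph dyadic_trickle (below x))"
    then have b: "b \<in> below x" by (simp add: full_subgraph_def)
    have "unroll_vert x a = unroll_vert x b \<longleftrightarrow> a = b"
      using bij a b by (auto simp: bij_betw_def inj_on_eq_iff)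
    then show "{unroll_vert x a, unroll_vert x b} \<in> edges dyadic_trickle
        \<longleftrightarrow> {a, b} \<in> edges (full_subgraph dyadic_trickle (below x))"
      using a b below bij_betwE[OF bij] by (auto simp: full_subgraph_def)
    show "unroll_vert x (aut (full_subgraph dyadic_trickle (below x)) a b)
        = act (unroll_vert x a) (unroll_vert x b)"
      using unroll_vert_act[OF assms a b] by (simp add: full_subgraph_def)
    have "star (full_subgraph dyadic_trickle (below x)) a = below x"
      using a below by (auto simp: star_def full_subgraph_def)
    then have "act a b \<in> below x" using par a b unfolding parabolic_def by blast
    then show "aut (full_subgraph dyadic_trickle (below x)) a b \<in> verts (full_subgraph dyadic_trickle (below x))"
      by (simp add: full_subgraph_def)
  qed
  then have "Tr (full_subgraph dyadic_trickle (below x)) \<cong> Tr dyadic_trickle"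
    by (auto simp: induces_iso_def is_iso_def)
  then have "Tr (full_subgraph dyadic_trickle (below x)) \<cong> thompson_F"
    using Tr_iso_thompson by (rule iso_trans)
  then show ?thesis using trickle_graph_dyadic par bij iso by blast
qed

end
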